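(* Let $G=(V,E)$ be a graph and $X\subseteq V$. Then the following are equivalent: (a) $G$ can be realised as an infinitesimally rigid bar-joint framework in $\mathbb{R}^2$ such that the points assigned to $X$ lie on a line; (b) $G$ can be realised as an infinitesimally rigid point-line framework in $\mathbb{R}^2$ such that each vertex in $X$ is realised as a line and each vertex in $V\setminus X$ is realised as a point; (c) $G$ contains a spanning subgraph $G'=(V,E')$ such that $|E'|=2|V|-3$ and, for all $\emptyset\ne A\subseteq E'$ and all partitions $\{A_1,\dots,A_s\}$ of $A$, $$|A|\le\sum_{i=1}^s\bigl(2\nu_{V\setminus X}(A_i)+\nu_X(A_i)-2\bigr)+\nu_X(A)-1.$$
   Context: For $Y\subseteq V$ and $A\subseteq E$, $\nu_Y(A)$ denotes the number of vertices of $Y$ incident to edges in $A$. A bar-joint framework $(G,p)$ in $\mathbb{R}^2$ has infinitesimal motions $\dot p:V\to\mathbb{R}^2$ with $\langle p_i-p_j,\dot p_i-\dot p_j\rangle=0$ for $ij\in E$; it is infinitesimally rigid if this space has dimension $3$. A point-line framework $(G,p,\ell)$ in $\mathbb{R}^2$: the vertex set is partitioned into $V_P$ (points) and $V_L$ (lines), edges split into $E_{PP},E_{PL},E_{LL}$ by endpoint types; $p:V_P\to\mathbb{R}^2$, $\ell=(a,r):V_L\to\mathbb{S}^1\times\mathbb{R}$, line $j$ being $\{x:\langle x,a_j\rangle+r_j=0\}$; edges are point-point distance, point-line distance and line-line angle constraints. An infinitesimal motion is $(\dot p,\dot a,\dot r)$ with $\dot p_i,\dot a_j\in\mathbb{R}^2$,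 $\dot r_j\in\mathbb{R}$ satisfying $\langle p_i-p_j,\dot p_i-\dot p_j\rangle=0$ ($ij\in E_{PP}$), $\langle p_i,\dot a_j\rangle+\langle\dot p_i,a_j\rangle+\dot r_j=0$ ($ij\in E_{PL}$, $i\in V_P$), $\langle a_i,\dot a_j\rangle+\langle\dot a_i,a_j\rangle=0$ ($ij\in E_{LL}$), $\langle a_i,\dot a_i\rangle=0$ ($i\in V_L$); it is infinitesimally rigid if this space has dimension $3$. *)

theory Defs
  imports "HOL-Analysis.Analysis" "HOL-Library.Disjoint_Sets"
begin

text \<open>
  Graphs are finite and simple. The vertex set \<open>V\<close> is a finite type, and an edge \<open>ij\<close> is the
  two-element set \<open>{i, j}\<close>; a graph is given by its set of edges.
\<close>

definition simple_graph :: "'v::finite set set \<Rightarrow> bool" where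
  "simple_graph E \<longleftrightarrow> (\<forall>e\<in>E. card e = 2)"

definition nu :: "'v::finite set \<Rightarrow> 'v set set \<Rightarrow> nat" where
  "nu Y A = card {v \<in> Y. \<exists>e\<in>A. v \<in> e}"

definition bar_joint_motions ::
    "'v::finite set set \<Rightarrow> ('v \<Rightarrow> real^2) \<Rightarrow> (real^2^'v) set" where
  "bar_joint_motions E p =
     {p'. \<forall>i j. {i, j} \<in> E \<longrightarrow> (p i - p j) \<bullet> (p' $ i - p' $ j) = 0}"

definition bar_joint_inf_rigid :: "'v::finite set set \<Rightarrow> ('v \<Rightarrow> real^2) \<Rightarrow> bool" where
  "bar_joint_inf_rigid E p \<longleftrightarrow> dim (bar_joint_motions E p) = 3"

text \<open>
  In a point-line framework with line vertices \<open>L\<close> (and point vertices \<open>- L\<close>), only the values of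
  \<open>p\<close> on \<open>- L\<close> and of \<open>a\<close>, \<open>r\<close> on \<open>L\<close> are meaningful. The position \<open>r\<close> of the lines does not
  enter the linear system for the infinitesimal motions.
\<close>

definition point_line_framework ::
    "'v::finite set \<Rightarrow> 'v set set \<Rightarrow> ('v \<Rightarrow> real^2) \<Rightarrow> ('v \<Rightarrow> (real^2) \<times> real) \<Rightarrow> bool" where
  "point_line_framework L E p l \<longleftrightarrow> simple_graph E \<and> (\<forall>j\<in>L. l j \<in> sphere 0 1 \<times> UNIV)"

text \<open>
  A motion is a triple of maps \<open>V\<^sub>P \<rightarrow> \<real>\<^sup>2\<close>, \<open>V\<^sub>L \<rightarrow> \<real>\<^sup>2\<close>, \<open>V\<^sub>L \<rightarrow> \<real>\<close>. Such maps are represented as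
  vectors indexed by all vertices and vanishing outside \<open>V\<^sub>P\<close> and \<open>V\<^sub>L\<close>, respectively, so that the
  dimension of the motion space is not affected by the irrelevant coordinates.
\<close>

definition point_line_motions ::
    "'v::finite set \<Rightarrow> 'v set set \<Rightarrow> ('v \<Rightarrow> real^2) \<Rightarrow> ('v \<Rightarrow> (real^2) \<times> real) \<Rightarrow>
      ((real^2^'v) \<times> (real^2^'v) \<times> (real^'v)) set" where
  "point_line_motions L E p l =
     {(p', a', r').
        (\<forall>i. i \<in> L \<longrightarrow> p' $ i = 0) \<and>
        (\<forall>j. j \<notin> L \<longrightarrow> a' $ j = 0 \<and> r' $ j = 0) \<and>
        (\<forall>i j. {i, j} \<in> E \<and> i \<notin> L \<and> j \<notin> L \<longrightarrow> (p i - p j) \<bullet> (p' $ i - p' $ j) = 0) \<and>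
        (\<forall>i j. {i, j} \<in> E \<and> i \<notin> L \<and> j \<in> L \<longrightarrow>
           p i \<bullet> (a' $ j) + (p' $ i) \<bullet> fst (l j) + r' $ j = 0) \<and>
        (\<forall>i j. {i, j} \<in> E \<and> i \<in> L \<and> j \<in> L \<longrightarrow>
           fst (l i) \<bullet> (a' $ j) + (a' $ i) \<bullet> fst (l j) = 0) \<and>
        (\<forall>i\<in>L. fst (l i) \<bullet> (a' $ i) = 0)}"

definition point_line_inf_rigid ::
    "'v::finite set \<Rightarrow> 'v set set \<Rightarrow> ('v \<Rightarrow> real^2) \<Rightarrow> ('v \<Rightarrow> (real^2) \<times> real) \<Rightarrow> bool" where
  "point_line_inf_rigid L E p l \<longleftrightarrow> dim (point_line_motions L E p l) = 3"

end

theory Submission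
  imports Defs
begin

text \<open>
  Point-line and bar-joint frameworks are two affine pictures of the same projective object: lines
  correspond to points on the line at infinity, and a projective map moves that line to a finite
  one. This gives (b) \<open>\<Longrightarrow>\<close> (a).

  For (a) \<open>\<Longrightarrow>\<close> (c), the rank of an independent set \<open>A\<close> of rows is at most the rank of its columns
  other than those along the line carrying \<open>X\<close>, estimated block by block, plus the rank contributed
  by the columns along that line.

  For (c) \<open>\<Longrightarrow>\<close> (b), take parameters at which the rank of every set of rows is locally maximal.
  Then the derivative of a linear dependency between rows stays in the span of these rows. Suppose
  the rows of \<open>E'\<close> are dependent, and let \<open>C\<close> be a circuit. Differentiating its dependency in the
  points shows that in every motion of \<open>C\<close> all edges rotate with the same angular velocity. Hence
  \<open>card C\<close> is at least \<open>\<nu>\<^sub>X(C)\<close> plus the rank of the system that forbids rotations. Differentiating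
  dependencies of that system in the lines shows that its rank is at least
  \<open>\<Sum>\<^sub>i (2\<nu>\<^bsub>V-X\<^esub>(A\<^sub>i) + \<nu>\<^sub>X(A\<^sub>i) - 2)\<close> for some partition of \<open>C\<close>, contradicting (c).
\<close>

section \<open>Dimension and generic rank\<close>

text \<open>Genericity is a condition on ranks near one parameter value, since differentiation needs
  no more: a dependency at \<open>g\<close>, followed with fixed coefficients along a line from
  \<open>g\<close>, equals \<open>t\<close> times its derivative. This requires rows that are affine
  along the line. A point-line row contains the product of a position and a normal, so the two kinds
  of parameters are never varied together: points are moved for the rows of the framework, lines for
  the rows without rotations. Normals keep arbitrary length until the end, so that the parameters
  form an open subset of a vector space. The bound in (c) is just strong enough to exclude circuits.
  A circuit has rank \<open>card C - 1\<close>, and its motions have at most one dimension more than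
  those without rotation. These two ones cancel, leaving a lower bound on \<open>card C\<close> that
  exceeds the upper bound of (c) by its final \<open>- 1\<close>. Each \<open>- 2\<close> stands for
  two trivial motions of a block: the two translations in (c) \<Longrightarrow> (b), the normal
  translation and a rotation in (a) \<Longrightarrow> (c).\<close>

definition indep_family :: "('s \<Rightarrow> 'b::real_vector) \<Rightarrow> 's set \<Rightarrow> bool" where
  "indep_family v S \<longleftrightarrow> (\<forall>c. (\<Sum>s\<in>S. c s *\<^sub>R v s) = 0 \<longrightarrow> (\<forall>s\<in>S. c s = 0))"

text \<open>Two equal members give a dependency with coefficients 1 and -1. Thus equal rows of
  different edges count as dependent, which independence of the image set would overlook.\<close>

lemma indep_family_imp_inj_on:
  assumes "finite S" "indep_family v S"
  shows "inj_on v S"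
proof (rule inj_onI, rule ccontr)
  fix s t assume st: "s \<in> S" "t \<in> S" "v s = v t" "s \<noteq> t"
  let ?c = "\<lambda>r. if r = s then 1 else if r = t then -1 else (0::real)"
  have "(\<Sum>r\<in>S. ?c r *\<^sub>R v r) = (\<Sum>r\<in>{s,t}. ?c r *\<^sub>R v r)"
    using assms st by (intro sum.mono_neutral_right) auto
  also have "\<dots> = 0" using st by simp
  finally have "\<forall>r\<in>S. ?c r = 0"
    using assms(2)[unfolded indep_family_def, rule_format, of ?c] by blast
  then show False using st(1) by fastforce
qed

lemma indep_family_imp_dim:
  fixes v :: "'s \<Rightarrow> 'b::euclidean_space"
  assumes "finite S" "indep_family v S"
  shows "dim (v ` S) = card S"
proof -
  have inj: "inj_on v S" by (rule indep_family_imp_inj_on[OF assms])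
  have "independent (v ` S)"
  proof (rule independent_if_scalars_zero)
    show "finite (v ` S)" using assms by simp
    fix f x assume f: "(\<Sum>x\<in>v ` S. f x *\<^sub>R x) = 0" "x \<in> v ` S"
    have "(\<Sum>s\<in>S. f (v s) *\<^sub>R v s) = 0"
      using f(1) by (simp add: sum.reindex[OF inj])
    then show "f x = 0" using f(2) assms(2) unfolding indep_family_def
      by (metis imageE)
  qed
  then show ?thesis using inj by (simp add: dim_eq_card_independent card_image)
qed

text \<open>Lower semicontinuity of the rank. Functionals dual to a basis chosen among the vectors
  at \<open>g\<close>, evaluated on the same members at a nearby \<open>h\<close>, give a matrix
  close to the identity, hence nonsingular.\<close>

lemma eventually_dim_image_ge:
  fixes u :: "'s \<Rightarrow> 'a::topological_space \<Rightarrow> 'b::euclidean_space"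
  assumes fin: "finite S" and cont: "\<And>s. s \<in> S \<Longrightarrow> (u s \<longlongrightarrow> u s g) (nhds g)"
  shows "eventually (\<lambda>h. dim ((\<lambda>s. u s g) ` S) \<le> dim ((\<lambda>s. u s h) ` S)) (nhds g)"
proof -
  obtain B where B: "B \<subseteq> (\<lambda>s. u s g) ` S" "independent B"
      "card B = dim ((\<lambda>s. u s g) ` S)"
    using basis_exists[of "(\<lambda>s. u s g) ` S"] by metis
  then obtain T where T: "T \<subseteq> S" "inj_on (\<lambda>s. u s g) T" "B = (\<lambda>s. u s g) ` T"
    using subset_image_inj by metis
  have finT: "finite T" using T fin finite_subset by blast
  define n where "n = card T"
  have "\<exists>f::'b \<Rightarrow> real. linear f \<and> (\<forall>t\<in>T. f (u t g) = (if t = s then 1 else 0))"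
    for s
  proof -
    have "\<exists>f::'b \<Rightarrow> real. linear f \<and>
        (\<forall>x\<in>B. f x = (if the_inv_into T (\<lambda>s. u s g) x = s then 1 else 0))"
      by (rule linear_independent_extend[OF B(2)])
    then obtain f :: "'b \<Rightarrow> real" where f: "linear f"
        "\<forall>x\<in>B. f x = (if the_inv_into T (\<lambda>s. u s g) x = s then 1 else 0)"
      by blast
    have "the_inv_into T (\<lambda>s. u s g) (u t g) = t" if "t \<in> T" for t
      using the_inv_into_f_f[OF T(2) that] .
    then show ?thesis
      using f T(3) by (intro exI[of _ f]) simp
  qed
  then obtain f :: "'s \<Rightarrow> 'b \<Rightarrow> real" where f: "\<And>s. linear (f s)"
      "\<And>s t. t \<in> T \<Longrightarrow> f s (u t g) = (if t = s then 1 else 0)"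
    by metis
  \<comment> \<open>The bound \<open>1 / (n + 1)\<close> keeps a sum of \<open>n\<close> such errors
    strictly below 1, so the matrix is diagonally dominant; \<open>n = 0\<close> is covered.\<close>
  have "eventually (\<lambda>h. \<forall>s\<in>T. \<forall>t\<in>T. \<bar>f s (u t h) - f s (u t g)\<bar> < 1 / (n + 1)) (nhds g)"
  proof (intro eventually_ball_finite ballI finT)
    fix s t assume "s \<in> T" "t \<in> T"
    then have "(u t \<longlongrightarrow> u t g) (nhds g)" using cont T(1) by blast
    moreover have "isCont (f s) (u t g)"
      using f(1) linear_continuous_at linear_conv_bounded_linear by blast
    ultimately have "((\<lambda>h. f s (u t h)) \<longlongrightarrow> f s (u t g)) (nhds g)"
      using isCont_tendsto_compose by blast
    then have "eventually (\<lambda>h. dist (f s (u t h)) (f s (u t g)) < 1 / (n + 1)) (nhds g)"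
      by (rule tendstoD) simp
    then show "eventually (\<lambda>h. \<bar>f s (u t h) - f s (u t g)\<bar> < 1 / (n + 1)) (nhds g)"
      by (simp add: dist_real_def)
  qed
  then show ?thesis
  proof (rule eventually_mono)
    fix h assume h: "\<forall>s\<in>T. \<forall>t\<in>T. \<bar>f s (u t h) - f s (u t g)\<bar> < 1 / (n + 1)"
    have "indep_family (\<lambda>s. u s h) T"
      unfolding indep_family_def
    proof (intro allI impI, rule ccontr)
      fix c assume c: "(\<Sum>s\<in>T. c s *\<^sub>R u s h) = 0" and "\<not> (\<forall>s\<in>T. c s = 0)"
      then have ne: "T \<noteq> {}" by auto
      define m where "m = Max ((\<lambda>s. \<bar>c s\<bar>) ` T)"
      have "m \<in> (\<lambda>s. \<bar>c s\<bar>) ` T" unfolding m_def using finT ne by (intro Max_in) auto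
      then obtain s where s: "s \<in> T" "m = \<bar>c s\<bar>" by auto
      have le: "\<bar>c t\<bar> \<le> m" if "t \<in> T" for t unfolding m_def using finT that by simp
      have mpos: "m > 0" using \<open>\<not> (\<forall>s\<in>T. c s = 0)\<close> le by fastforce
      have "0 = f s (\<Sum>t\<in>T. c t *\<^sub>R u t h)" using c linear_0[OF f(1)] by simp
      also have "\<dots> = (\<Sum>t\<in>T. c t * f s (u t h))"
        using f(1) by (simp add: linear_sum linear_cmul)
      also have "\<dots> = (\<Sum>t\<in>T. c t * (f s (u t h) - f s (u t g))) + (\<Sum>t\<in>T. c t * f s (u t g))"
        by (simp add: sum.distrib[symmetric] algebra_simps)
      also have "(\<Sum>t\<in>T. c t * f s (u t g)) = (\<Sum>t\<in>T. if t = s then c t else 0)"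
        by (intro sum.cong) (auto simp: f(2))
      also have "\<dots> = c s" using finT s by simp
      finally have "\<bar>c s\<bar> = \<bar>\<Sum>t\<in>T. c t * (f s (u t h) - f s (u t g))\<bar>" by linarith
      also have "\<dots> \<le> (\<Sum>t\<in>T. \<bar>c t\<bar> * \<bar>f s (u t h) - f s (u t g)\<bar>)"
        by (rule order_trans[OF sum_abs]) (simp add: abs_mult)
      also have "\<dots> \<le> (\<Sum>t\<in>T. m * (1 / (n + 1)))"
        using le h s by (intro sum_mono mult_mono) (auto intro: less_imp_le)
      also have "\<dots> = m * (n / (n + 1))" by (simp add: n_def)
      also have "\<dots> < m * 1" using mpos by (intro mult_strict_left_mono) auto
      finally show False using s by simp
    qed
    then have "dim ((\<lambda>s. u s h) ` T) = card T" by (rule indep_family_imp_dim[OF finT])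
    moreover have "card T = dim ((\<lambda>s. u s g) ` S)" using T B(3) by (simp add: card_image)
    moreover have "dim ((\<lambda>s. u s h) ` T) \<le> dim ((\<lambda>s. u s h) ` S)"
      using T(1) by (intro dim_subset image_mono)
    ultimately show "dim ((\<lambda>s. u s g) ` S) \<le> dim ((\<lambda>s. u s h) ` S)" by simp
  qed
qed

text \<open>Local maximality of all ranks at once takes the place of algebraic independence of the
  coordinates.\<close>

definition generic_at :: "('s \<Rightarrow> 'a::topological_space \<Rightarrow> 'b::euclidean_space) \<Rightarrow> 's set \<Rightarrow> 'a \<Rightarrow> bool" where
  "generic_at u I g \<longleftrightarrow>
     (\<forall>S\<subseteq>I. eventually (\<lambda>h. dim ((\<lambda>s. u s h) ` S) \<le> dim ((\<lambda>s. u s g) ` S)) (nhds g))"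

text \<open>The sum of the ranks of all subfamilies is a bounded integer and attains a maximum on
  \<open>U\<close>. Near a maximiser no single rank drops, so none can rise.\<close>

lemma generic_at_exists:
  fixes u :: "'s \<Rightarrow> 'a::topological_space \<Rightarrow> 'b::euclidean_space"
  assumes fin: "finite I" and "\<And>s. s \<in> I \<Longrightarrow> continuous_on UNIV (u s)"
    and U: "open U" "U \<noteq> {}"
  shows "\<exists>g\<in>U. generic_at u I g"
proof -
  let ?d = "\<lambda>h S. dim ((\<lambda>s. u s h) ` S)"
  let ?D = "\<lambda>h. \<Sum>S\<in>Pow I. ?d h S"
  obtain g0 where "g0 \<in> U" using U by blast
  moreover have "\<forall>h. h \<in> U \<longrightarrow> ?D h < card (Pow I) * DIM('b) + 1"
  proof (intro allI impI)
    fix h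
    have "?D h \<le> card (Pow I) * DIM('b)"
      by (intro order_trans[OF sum_bounded_above]) (auto intro: dim_subset_UNIV)
    then show "?D h < card (Pow I) * DIM('b) + 1" by simp
  qed
  ultimately obtain g where g: "g \<in> U" and max: "\<And>h. h \<in> U \<Longrightarrow> ?D h \<le> ?D g"
    using ex_has_greatest_nat[of "\<lambda>h. h \<in> U" g0 ?D] by blast
  have "eventually (\<lambda>h. h \<in> U) (nhds g)" using g U(1) by (rule eventually_nhds_in_open[rotated])
  moreover have "eventually (\<lambda>h. \<forall>S\<in>Pow I. ?d g S \<le> ?d h S) (nhds g)"
  proof (intro eventually_ball_finite ballI)
    show "finite (Pow I)" using fin by simp
    fix S assume S: "S \<in> Pow I"
    show "eventually (\<lambda>h. ?d g S \<le> ?d h S) (nhds g)"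
    proof (rule eventually_dim_image_ge)
      show "finite S" using S fin finite_subset by blast
      fix s assume "s \<in> S"
      then have "continuous_on UNIV (u s)" using S assms(2) by blast
      then show "(u s \<longlongrightarrow> u s g) (nhds g)"
        by (simp add: continuous_on_def tendsto_at_iff_tendsto_nhds)
    qed
  qed
  ultimately have "eventually (\<lambda>h. \<forall>S\<in>Pow I. ?d h S \<le> ?d g S) (nhds g)"
  proof eventually_elim
    fix h assume h: "h \<in> U" "\<forall>S\<in>Pow I. ?d g S \<le> ?d h S"
    show "\<forall>S\<in>Pow I. ?d h S \<le> ?d g S"
    proof (rule ballI, rule ccontr)
      fix S assume "S \<in> Pow I" "\<not> ?d h S \<le> ?d g S"
      then have "?D g < ?D h" using h fin
        by (intro sum_strict_mono_ex1) (auto intro!: bexI[of _ S])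
      then show False using max[OF h(1)] by simp
    qed
  qed
  then have "generic_at u I g" unfolding generic_at_def
    by (auto elim: eventually_mono)
  then show ?thesis using g by blast
qed

text \<open>The combination of the \<open>D s\<close> lies in the span of the \<open>u s\<close> at
  \<open>g + t *\<^sub>R b\<close> for every nonzero \<open>t\<close>. Were it outside the span at
  \<open>g\<close>, it would stay outside for small \<open>t\<close>: adjoining it raises the rank
  at \<open>g\<close>, this larger rank persists nearby, and the rank of the \<open>u s\<close>
  alone does not grow.\<close>

lemma generic_at_derivative_in_span:
  fixes u :: "'s \<Rightarrow> 'a::real_normed_vector \<Rightarrow> 'b::euclidean_space"
  assumes fin: "finite S" and gen: "generic_at u I g" and SI: "S \<subseteq> I"
    and cont: "\<And>s. s \<in> S \<Longrightarrow> continuous_on UNIV (u s)"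
    and line: "\<And>s t. s \<in> S \<Longrightarrow> u s (g + t *\<^sub>R b) = u s g + t *\<^sub>R D s"
    and dep: "(\<Sum>s\<in>S. c s *\<^sub>R u s g) = 0"
  shows "(\<Sum>s\<in>S. c s *\<^sub>R D s) \<in> span ((\<lambda>s. u s g) ` S)"
proof (rule ccontr)
  define z where "z = (\<Sum>s\<in>S. c s *\<^sub>R D s)"
  assume "\<not> ?thesis"
  then have z: "z \<notin> span ((\<lambda>s. u s g) ` S)" by (simp add: z_def)
  \<comment> \<open>The vector \<open>z\<close> becomes a constant member with index
    \<open>None\<close>, so that semicontinuity applies to the enlarged family.\<close>
  define w where "w = (\<lambda>i h. case i of None \<Rightarrow> z | Some s \<Rightarrow> u s h)"
  have im: "(\<lambda>i. w i h) ` (insert None (Some ` S)) = insert z ((\<lambda>s. u s h) ` S)" for h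
    by (auto simp: w_def image_iff)
  have "eventually (\<lambda>h. dim ((\<lambda>i. w i g) ` (insert None (Some ` S)))
      \<le> dim ((\<lambda>i. w i h) ` (insert None (Some ` S)))) (nhds g)"
  proof (rule eventually_dim_image_ge)
    fix i assume "i \<in> insert None (Some ` S)"
    then have "continuous_on UNIV (w i)" using cont by (auto simp: w_def)
    then show "(w i \<longlongrightarrow> w i g) (nhds g)"
      by (simp add: continuous_on_def tendsto_at_iff_tendsto_nhds)
  qed (use fin in simp)
  moreover have "eventually (\<lambda>h. dim ((\<lambda>s. u s h) ` S) \<le> dim ((\<lambda>s. u s g) ` S)) (nhds g)"
    using gen SI unfolding generic_at_def by blast
  ultimately have "eventually (\<lambda>h. z \<notin> span ((\<lambda>s. u s h) ` S)) (nhds g)"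
  proof eventually_elim
    case (elim h)
    then show ?case using z unfolding im dim_insert by (auto split: if_splits)
  qed
  moreover have "((\<lambda>t. g + t *\<^sub>R b) \<longlongrightarrow> g) (at 0)"
    by (auto intro!: tendsto_eq_intros)
  ultimately have "eventually (\<lambda>t. z \<notin> span ((\<lambda>s. u s (g + t *\<^sub>R b)) ` S)) (at 0)"
    by (rule eventually_compose_filterlim)
  moreover have "eventually (\<lambda>t::real. t \<noteq> 0) (at 0)"
    by (simp add: eventually_at_filter)
  ultimately have "eventually (\<lambda>t::real. False) (at 0)"
  proof eventually_elim
    case (elim t)
    have "(\<Sum>s\<in>S. c s *\<^sub>R u s (g + t *\<^sub>R b)) = t *\<^sub>R z"
      using dep by (simp add: line z_def scaleR_add_right sum.distrib scaleR_sum_right mult.commute)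
    then have "z = (1 / t) *\<^sub>R (\<Sum>s\<in>S. c s *\<^sub>R u s (g + t *\<^sub>R b))" using elim by simp
    also have "\<dots> \<in> span ((\<lambda>s. u s (g + t *\<^sub>R b)) ` S)"
      by (intro span_scale span_sum) (auto intro: span_base)
    finally show False using elim by simp
  qed
  then show False by simp
qed

section \<open>Dimension counts for sums, kernels and orthogonal complements\<close>

lemma dim_le_sum_dim:
  fixes S :: "'b::euclidean_space set"
  assumes "S \<subseteq> {x + y |x y. x \<in> T1 \<and> y \<in> T2}" "subspace T1" "subspace T2"
  shows "dim S \<le> dim T1 + dim T2"
  using dim_subset[OF assms(1)] dim_sums_Int[OF assms(2,3)] by linarith

lemma dim_orthogonal_complement:
  fixes R :: "'b::euclidean_space set"
  shows "dim {z. \<forall>x\<in>R. x \<bullet> z = 0} + dim R = DIM('b)"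
proof -
  have "{z. \<forall>x\<in>R. x \<bullet> z = 0} = {z \<in> UNIV. \<forall>x\<in>span R. orthogonal x z}"
  proof (intro set_eqI iffI; clarsimp)
    fix z x assume "\<forall>x\<in>R. x \<bullet> z = 0" "x \<in> span R"
    then show "orthogonal x z"
      using orthogonal_to_span[of x R z] by (simp add: orthogonal_def inner_commute)
  qed (simp add: orthogonal_def span_base)
  then show ?thesis
    using dim_subspace_orthogonal_to_vectors[of "span R" UNIV] by simp
qed

lemma dim_le_linear_inj_on:
  fixes f :: "'a::euclidean_space \<Rightarrow> 'b::euclidean_space"
  assumes "linear f" "subspace S" "inj_on f S" "f ` S \<subseteq> T"
  shows "dim S \<le> dim T"
proof -
  have "inj_on f (span S)" using assms(2,3) by (simp add: span_eq_iff[THEN iffD2])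
  then have "dim (f ` S) = dim S" by (rule dim_image_eq[OF assms(1)])
  then show ?thesis using dim_subset[OF assms(4)] by simp
qed

lemma dim_UN_le:
  fixes S :: "'i \<Rightarrow> 'b::euclidean_space set"
  assumes "finite I"
  shows "dim (\<Union>i\<in>I. S i) \<le> (\<Sum>i\<in>I. dim (S i))"
  using assms
proof (induction I rule: finite_induct)
  case (insert i I)
  let ?U = "\<Union>i\<in>I. S i"
  have "S i \<union> ?U \<subseteq> {x + y |x y. x \<in> span (S i) \<and> y \<in> span ?U}"
  proof
    fix x assume "x \<in> S i \<union> ?U"
    then have "x \<in> span (S i) \<or> x \<in> span ?U" by (auto intro: span_base)
    then show "x \<in> {x + y |x y. x \<in> span (S i) \<and> y \<in> span ?U}"
    proof
      assume "x \<in> span (S i)"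
      then have "x = x + 0 \<and> x \<in> span (S i) \<and> 0 \<in> span ?U" by (simp add: span_zero)
      then show ?thesis by blast
    next
      assume "x \<in> span ?U"
      then have "x = 0 + x \<and> 0 \<in> span (S i) \<and> x \<in> span ?U" by (simp add: span_zero)
      then show ?thesis by blast
    qed
  qed
  then have "dim (S i \<union> ?U) \<le> dim (S i) + dim ?U"
    using dim_le_sum_dim[of "S i \<union> ?U" "span (S i)" "span ?U"] by simp
  then show ?case using insert by simp
qed simp

lemma dim_le_dim_image_plus_kernel:
  fixes f :: "'a::euclidean_space \<Rightarrow> 'b::euclidean_space"
  assumes f: "linear f" and W: "subspace W"
  shows "dim W \<le> dim (f ` W) + dim {x \<in> W. f x = 0}"
proof -
  let ?K = "{x \<in> W. f x = 0}"
  let ?C = "{y \<in> W. \<forall>x\<in>?K. orthogonal x y}"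
  have K: "subspace ?K"
    using W linear_subspace_kernel[OF f] subspace_inter[of W "{x. f x = 0}"]
    by (simp add: Int_def)
  have C: "subspace ?C"
    using W by (auto simp: subspace_def orthogonal_def inner_add_right)
  have "inj_on f ?C"
  proof (rule inj_onI)
    fix x y assume xy: "x \<in> ?C" "y \<in> ?C" "f x = f y"
    have C': "x - y \<in> ?C" using subspace_diff[OF C xy(1,2)] .
    moreover have "f (x - y) = 0" using xy(3) linear_diff[OF f] by simp
    ultimately have "orthogonal (x - y) (x - y)" by blast
    then show "x = y" by (simp add: orthogonal_self)
  qed
  then have "dim ?C \<le> dim (f ` W)" by (intro dim_le_linear_inj_on[OF f C]) auto
  moreover have "dim ?C + dim ?K = dim W"
    by (rule dim_subspace_orthogonal_to_vectors[OF K W]) auto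
  ultimately show ?thesis by simp
qed

text \<open>Each independent vector orthogonal to all rows lowers the bound on their rank by one. In
  \<open>collinear_rank_bound\<close> this produces both the \<open>- 2\<close> of each block and
  the \<open>- 1\<close>.\<close>

lemma dim_plus_dim_orthogonal_le:
  fixes R T Q :: "'b::euclidean_space set"
  assumes "R \<subseteq> span Q" "T \<subseteq> span Q" "finite Q" and orth: "\<And>x t. x \<in> R \<Longrightarrow> t \<in> T \<Longrightarrow> x \<bullet> t = 0"
  shows "dim R + dim T \<le> card Q"
proof -
  have sub: "span R \<subseteq> span Q" using assms(1) by (simp add: span_minimal)
  have "dim {y \<in> span Q. \<forall>x\<in>span R. orthogonal x y} + dim (span R) = dim (span Q)"
    by (intro dim_subspace_orthogonal_to_vectors sub) auto
  moreover have "dim T \<le> dim {y \<in> span Q. \<forall>x\<in>span R. orthogonal x y}"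
  proof (intro dim_subset subsetI)
    fix t assume t: "t \<in> T"
    have "orthogonal x t" if x: "x \<in> span R" for x
      using orthogonal_to_span[OF x, of t] orth t by (simp add: orthogonal_def inner_commute)
    then show "t \<in> {y \<in> span Q. \<forall>x\<in>span R. orthogonal x y}" using t assms(2) by blast
  qed
  moreover have "dim (span Q) \<le> card Q" using assms(3) by (intro dim_le_card) auto
  ultimately show ?thesis by simp
qed

lemma span_image_coefficients:
  assumes "finite S" "x \<in> span (f ` S)"
  shows "\<exists>c. x = (\<Sum>s\<in>S. c s *\<^sub>R f s)"
proof -
  have "span (f ` S) \<subseteq> range (\<lambda>c. \<Sum>s\<in>S. c s *\<^sub>R f s)"
  proof (rule span_minimal)
    show "f ` S \<subseteq> range (\<lambda>c. \<Sum>s\<in>S. c s *\<^sub>R f s)"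
    proof (rule image_subsetI)
      fix s assume "s \<in> S"
      then have "f s = (\<Sum>t\<in>S. (if t = s then 1 else 0) *\<^sub>R f t)"
        using assms(1) by (simp add: if_distrib[of "\<lambda>r. r *\<^sub>R _"] cong: if_cong)
      then show "f s \<in> range (\<lambda>c. \<Sum>s\<in>S. c s *\<^sub>R f s)" 
        by (rule range_eqI[of _ _ "\<lambda>t. if t = s then 1 else 0"])
    qed
    show "subspace (range (\<lambda>c. \<Sum>s\<in>S. c s *\<^sub>R f s))"
    proof (rule subspaceI)
      show "0 \<in> range (\<lambda>c. \<Sum>s\<in>S. c s *\<^sub>R f s)" by (rule range_eqI[of _ _ "\<lambda>_. 0"]) simp
    next
      fix x y assume "x \<in> range (\<lambda>c. \<Sum>s\<in>S. c s *\<^sub>R f s)" "y \<in> range (\<lambda>c. \<Sum>s\<in>S. c s *\<^sub>R f s)"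
      then obtain c d where "x = (\<Sum>s\<in>S. c s *\<^sub>R f s)" "y = (\<Sum>s\<in>S. d s *\<^sub>R f s)" by blast
      then show "x + y \<in> range (\<lambda>c. \<Sum>s\<in>S. c s *\<^sub>R f s)"
        by (intro range_eqI[of _ _ "\<lambda>s. c s + d s"]) (simp add: scaleR_add_left sum.distrib)
    next
      fix r x assume "x \<in> range (\<lambda>c. \<Sum>s\<in>S. c s *\<^sub>R f s)"
      then obtain c where "x = (\<Sum>s\<in>S. c s *\<^sub>R f s)" by blast
      then show "r *\<^sub>R x \<in> range (\<lambda>c. \<Sum>s\<in>S. c s *\<^sub>R f s)"
        by (intro range_eqI[of _ _ "\<lambda>s. r * c s"]) (simp add: scaleR_sum_right)
    qed
  qed
  then show ?thesis using assms(2) by blast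
qed

lemma sum_dim_le_dim_UN_if_direct:
  fixes T :: "'i \<Rightarrow> 'b::euclidean_space set"
  assumes fin: "finite I"
    and direct: "\<And>w. (\<And>i. i \<in> I \<Longrightarrow> w i \<in> span (T i)) \<Longrightarrow> (\<Sum>i\<in>I. w i) = 0 \<Longrightarrow> \<forall>i\<in>I. w i = 0"
  shows "(\<Sum>i\<in>I. dim (T i)) \<le> dim (\<Union>i\<in>I. T i)"
proof -
  have "\<exists>b. b \<subseteq> T i \<and> independent b \<and> card b = dim (T i)" for i
    using basis_exists[of "T i"] by metis
  then obtain b where b: "\<And>i. b i \<subseteq> T i" "\<And>i. independent (b i)" "\<And>i. card (b i) = dim (T i)"
    by metis
  have finb: "finite (b i)" for i using b(2) by (rule finiteI_independent)
  have "indep_family snd (Sigma I b)"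
    unfolding indep_family_def
  proof (intro allI impI)
    fix c assume "(\<Sum>s\<in>Sigma I b. c s *\<^sub>R snd s) = 0"
    then have "(\<Sum>i\<in>I. \<Sum>x\<in>b i. c (i, x) *\<^sub>R x) = 0"
      using fin finb by (simp add: sum.Sigma case_prod_beta)
    moreover have "(\<Sum>x\<in>b i. c (i, x) *\<^sub>R x) \<in> span (T i)" for i
      using b(1) by (intro span_sum span_scale span_base) auto
    ultimately have 0: "\<forall>i\<in>I. (\<Sum>x\<in>b i. c (i, x) *\<^sub>R x) = 0"
      using direct[of "\<lambda>i. \<Sum>x\<in>b i. c (i, x) *\<^sub>R x"] by blast
    show "\<forall>s\<in>Sigma I b. c s = 0"
    proof safe
      fix i x assume "i \<in> I" "x \<in> b i"
      then show "c (i, x) = 0"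
        using 0 independentD[OF b(2) finb subset_refl, of "\<lambda>x. c (i, x)" i x] by simp
    qed
  qed
  then have "dim (snd ` Sigma I b) = card (Sigma I b)"
    using fin finb by (intro indep_family_imp_dim) auto
  also have "\<dots> = (\<Sum>i\<in>I. dim (T i))" using fin finb b(3) by simp
  finally have "(\<Sum>i\<in>I. dim (T i)) = dim (snd ` Sigma I b)" by simp
  also have "\<dots> \<le> dim (\<Union>i\<in>I. T i)" using b(1) by (intro dim_subset) force
  finally show ?thesis .
qed

section \<open>The Euclidean plane\<close>

definition perp :: "real^2 \<Rightarrow> real^2" where
  "perp u = vector [- u $ 2, u $ 1]"

lemma perp_nth [simp]: "perp u $ 1 = - u $ 2" "perp u $ 2 = u $ 1"
  by (simp_all add: perp_def)

lemma perp_add [simp]: "perp (u + v) = perp u + perp v"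
  and perp_diff [simp]: "perp (u - v) = perp u - perp v"
  and perp_scaleR [simp]: "perp (c *\<^sub>R u) = c *\<^sub>R perp u"
  and perp_perp [simp]: "perp (perp u) = - u"
  and perp_zero [simp]: "perp 0 = 0"
  by (auto simp: vec_eq_iff forall_2)

lemma inner_real2: "u \<bullet> v = u $ 1 * v $ 1 + u $ 2 * v $ 2" for u v :: "real^2"
  by (simp add: inner_vec_def sum_2)

lemma inner_perp_self [simp]: "u \<bullet> perp u = 0" "perp u \<bullet> u = 0"
  by (auto simp: inner_real2)

lemma inner_perp_swap: "perp u \<bullet> v = - (u \<bullet> perp v)"
  by (simp add: inner_real2)

lemma perp_eq_0_iff [simp]: "perp u = 0 \<longleftrightarrow> u = 0"
  by (auto simp: vec_eq_iff forall_2)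

lemma linear_perp: "linear perp"
  by (rule linearI) simp_all

lemma continuous_on_perp [continuous_intros]:
  fixes f :: "'a::topological_space \<Rightarrow> real^2"
  assumes "continuous_on S f"
  shows "continuous_on S (\<lambda>x. perp (f x))"
  using continuous_on_compose2[OF linear_continuous_on assms] linear_perp
  by (metis linear_conv_bounded_linear top_greatest)

lemma inner_eq_0_imp_perp_multiple:
  assumes "u \<noteq> 0" "u \<bullet> w = 0"
  obtains c where "w = c *\<^sub>R perp u"
proof
  have n: "u \<bullet> u \<noteq> 0" using assms by simp
  have "(u \<bullet> u) *\<^sub>R w = (perp u \<bullet> w) *\<^sub>R perp u + (u \<bullet> w) *\<^sub>R u"
    by (simp add: vec_eq_iff forall_2 inner_real2) (simp add: algebra_simps)
  then have "w = (1 / (u \<bullet> u)) *\<^sub>R ((perp u \<bullet> w) *\<^sub>R perp u)"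
    using n assms(2) by (metis add.right_neutral scaleR_one scaleR_scaleR scaleR_zero_left nonzero_divide_eq_eq)
  then show "w = ((perp u \<bullet> w) / (u \<bullet> u)) *\<^sub>R perp u" by simp
qed

lemma collinear_if_inner_const:
  fixes S :: "(real^2) set"
  assumes "a \<noteq> 0" "\<And>x. x \<in> S \<Longrightarrow> a \<bullet> x = d"
  shows "collinear S"
  unfolding collinear_def
proof (intro exI[of _ "perp a"] ballI)
  fix x y assume "x \<in> S" "y \<in> S"
  then have "a \<bullet> (x - y) = 0" using assms(2) by (simp add: inner_diff_right)
  then show "\<exists>c. x - y = c *\<^sub>R perp a"
    using inner_eq_0_imp_perp_multiple[OF assms(1)] by metis
qed

lemma collinear_imp_inner_const:
  fixes S :: "(real^2) set"
  assumes "collinear S"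
  obtains a d where "a \<noteq> 0" "\<And>x. x \<in> S \<Longrightarrow> a \<bullet> x = d"
proof -
  obtain u where u: "\<And>x y. x \<in> S \<Longrightarrow> y \<in> S \<Longrightarrow> \<exists>c. x - y = c *\<^sub>R u"
    using assms unfolding collinear_def by blast
  \<comment> \<open>If \<open>u = 0\<close>, then \<open>S\<close> has at most one point and any
    direction serves.\<close>
  define v :: "real^2" where "v = (if u = 0 then axis 1 1 else u)"
  have v0: "v \<noteq> 0" by (simp add: v_def axis_eq_0_iff)
  have "perp v \<bullet> x = perp v \<bullet> y" if xy: "x \<in> S" "y \<in> S" for x y
  proof -
    obtain c where "x - y = c *\<^sub>R u" using u[OF xy] by blast
    then have "x - y = c *\<^sub>R v \<or> x - y = 0" by (cases "u = 0") (simp_all add: v_def)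
    then have "perp v \<bullet> (x - y) = 0" by auto
    then show ?thesis by (simp add: inner_diff_right)
  qed
  moreover have "perp v \<noteq> 0" using v0 by simp
  ultimately show thesis using that[of "perp v" "perp v \<bullet> (SOME x. x \<in> S)"]
    by (metis someI)
qed

section \<open>Spans of directions chosen separately at each vertex\<close>

lemma vec_in_span_axes:
  fixes z :: "real^2^'v::finite"
  assumes supp: "\<And>k. k \<notin> S \<Longrightarrow> z $ k = 0"
    and comp: "\<And>k. k \<in> S \<Longrightarrow> z $ k \<in> span (D k)"
  shows "z \<in> span (\<Union>k\<in>S. axis k ` D k)"
proof -
  have "z = (\<Sum>k\<in>S. axis k (z $ k))"
    using supp by (simp add: vec_eq_iff axis_def sum.delta')
  moreover have "axis k (z $ k) \<in> span (\<Union>k\<in>S. axis k ` D k)" if k: "k \<in> S" for k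
  proof -
    have lin: "linear (axis k :: real^2 \<Rightarrow> _)"
      by (rule linearI) (auto simp: axis_def vec_eq_iff)
    have "axis k (z $ k) \<in> axis k ` span (D k)" using comp[OF k] by blast
    also have "\<dots> = span (axis k ` D k)" using linear_span_image[OF lin] by simp
    also have "\<dots> \<subseteq> span (\<Union>k\<in>S. axis k ` D k)" using k by (intro span_mono) auto
    finally show ?thesis .
  qed
  ultimately show ?thesis by (metis (no_types, lifting) span_sum)
qed

lemma card_UN_axes_le:
  fixes D :: "'v::finite \<Rightarrow> (real^2) set"
  assumes "\<And>k. finite (D k)"
  shows "card (\<Union>k\<in>S. axis k ` D k :: (real^2^'v) set) \<le> (\<Sum>k\<in>S. card (D k))"
proof -
  have "card (\<Union>k\<in>S. axis k ` D k :: (real^2^'v) set) \<le> (\<Sum>k\<in>S. card (axis k ` D k :: (real^2^'v) set))"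
    by (rule card_UN_le) simp
  also have "\<dots> \<le> (\<Sum>k\<in>S. card (D k))"
    by (intro sum_mono card_image_le assms)
  finally show ?thesis .
qed

lemma span_axes_real2: "span {axis 1 1, axis 2 1 :: real^2} = UNIV"
proof -
  have "x \<in> span {axis 1 1, axis 2 1 :: real^2}" for x
  proof -
    have "x = x $ 1 *\<^sub>R axis 1 1 + x $ 2 *\<^sub>R axis 2 1"
      by (auto simp: vec_eq_iff forall_2 axis_def)
    then show ?thesis by (metis span_add span_base span_scale insertI1 insertI2)
  qed
  then show ?thesis by blast
qed

lemma card_axes_real2: "card {axis 1 1, axis 2 1 :: real^2} = 2"
  by (simp add: axis_eq_axis)

lemma dim_UN_axes:
  fixes D :: "'v::finite \<Rightarrow> (real^2) set"
  assumes D: "\<And>k. D k \<subseteq> Basis"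
  shows "dim (\<Union>k\<in>S. axis k ` D k :: (real^2^'v) set) = (\<Sum>k\<in>S. card (D k))"
proof -
  have zero: "0 \<notin> D k" for k using D[of k] by auto
  have fin: "finite (D k)" for k using D finite_subset finite_Basis by blast
  have "(\<Union>k\<in>S. axis k ` D k :: (real^2^'v) set) \<subseteq> Basis"
    using D by (fastforce simp: Basis_vec_def)
  then have "dim (\<Union>k\<in>S. axis k ` D k :: (real^2^'v) set) = card (\<Union>k\<in>S. axis k ` D k :: (real^2^'v) set)"
    using independent_Basis independent_mono dim_eq_card_independent by blast
  also have "\<dots> = (\<Sum>k\<in>S. card (axis k ` D k :: (real^2^'v) set))"
  proof (rule card_UN_disjoint)
    show "\<forall>i\<in>S. \<forall>j\<in>S. i \<noteq> j \<longrightarrow> (axis i ` D i :: (real^2^'v) set) \<inter> axis j ` D j = {}"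
      using zero by (auto simp: axis_eq_axis)
  qed (use fin in auto)
  also have "\<dots> = (\<Sum>k\<in>S. card (D k))"
    by (intro sum.cong refl card_image inj_onI) (auto simp: axis_eq_axis)
  finally show ?thesis .
qed

section \<open>From point-line to bar-joint frameworks\<close>

text \<open>On the parabola of points \<open>(x, x\<^sup>2)\<close> each condition says that
  \<open>x\<close> is not a root of a certain nonzero polynomial, and finitely many polynomials have
  finitely many roots.\<close>

lemma exists_projective_direction:
  fixes q :: "'v::finite \<Rightarrow> (real^2) \<times> real"
  assumes "\<And>i. q i \<noteq> 0"
  shows "\<exists>\<alpha>. \<forall>i. \<alpha> \<bullet> fst (q i) + snd (q i) \<noteq> 0"
proof -
  let ?P = "\<lambda>i. [:snd (q i), fst (q i) $ 1, fst (q i) $ 2:]"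
  have "?P i \<noteq> 0" for i
  proof
    assume "?P i = 0"
    then have "snd (q i) = 0" "fst (q i) = 0" by (auto simp: vec_eq_iff forall_2)
    then show False using assms[of i] by (simp add: prod_eq_iff)
  qed
  then have "finite (\<Union>i. {x. poly (?P i) x = 0})" by (intro finite_UN_I poly_roots_finite) auto
  then obtain x where x: "x \<notin> (\<Union>i. {x. poly (?P i) x = 0})"
    using ex_new_if_finite infinite_UNIV_char_0 by blast
  have "vector [x, x\<^sup>2] \<bullet> fst (q i) + snd (q i) = poly (?P i) x" for i
    by (simp add: inner_vec_def sum_2 power2_eq_square algebra_simps)
  then show ?thesis using x by (intro exI[of _ "vector [x, x\<^sup>2]"]) (simp del: poly_pCons)
qed

lemma subspace_bar_joint_motions:
  fixes P :: "'v::finite \<Rightarrow> real^2"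
  shows "subspace (bar_joint_motions E P)"
proof -
  have "(P i - P j) \<bullet> (x $ i + y $ i - (x $ j + y $ j))
      = (P i - P j) \<bullet> (x $ i - x $ j) + (P i - P j) \<bullet> (y $ i - y $ j)"
    "(P i - P j) \<bullet> (c *\<^sub>R x $ i - c *\<^sub>R x $ j) = c * ((P i - P j) \<bullet> (x $ i - x $ j))"
    for x y :: "real^2^'v" and i j c
    by (simp_all add: algebra_simps)
  then show ?thesis by (auto simp: subspace_def bar_joint_motions_def)
qed

lemma subspace_point_line_motions: "subspace (point_line_motions L E p l)"
proof -
  define PP where "PP i j z = (p i - p j) \<bullet> (fst z $ i - fst z $ j)"
    for i j and z :: "(real^2^'a) \<times> (real^2^'a) \<times> (real^'a)"
  define PL where "PL i j z = p i \<bullet> (fst (snd z) $ j) + (fst z $ i) \<bullet> fst (l j) + snd (snd z) $ j"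
    for i j and z :: "(real^2^'a) \<times> (real^2^'a) \<times> (real^'a)"
  define LL where "LL i j z = fst (l i) \<bullet> (fst (snd z) $ j) + (fst (snd z) $ i) \<bullet> fst (l j)"
    for i j and z :: "(real^2^'a) \<times> (real^2^'a) \<times> (real^'a)"
  have lin: "PP i j (x + y) = PP i j x + PP i j y" "PP i j (c *\<^sub>R x) = c * PP i j x"
    "PL i j (x + y) = PL i j x + PL i j y" "PL i j (c *\<^sub>R x) = c * PL i j x"
    "LL i j (x + y) = LL i j x + LL i j y" "LL i j (c *\<^sub>R x) = c * LL i j x" for i j x y c
    by (simp_all add: PP_def PL_def LL_def algebra_simps)
  have zero: "PP i j 0 = 0" "PL i j 0 = 0" "LL i j 0 = 0" for i j
    by (simp_all add: PP_def PL_def LL_def)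
  have "point_line_motions L E p l = {z. (\<forall>i\<in>L. fst z $ i = 0)
      \<and> (\<forall>j. j \<notin> L \<longrightarrow> fst (snd z) $ j = 0 \<and> snd (snd z) $ j = 0)
      \<and> (\<forall>i j. {i, j} \<in> E \<and> i \<notin> L \<and> j \<notin> L \<longrightarrow> PP i j z = 0)
      \<and> (\<forall>i j. {i, j} \<in> E \<and> i \<notin> L \<and> j \<in> L \<longrightarrow> PL i j z = 0)
      \<and> (\<forall>i j. {i, j} \<in> E \<and> i \<in> L \<and> j \<in> L \<longrightarrow> LL i j z = 0)
      \<and> (\<forall>i\<in>L. fst (l i) \<bullet> (fst (snd z) $ i) = 0)}"
    by (auto simp: point_line_motions_def PP_def PL_def LL_def)
  then show ?thesis
    by (simp only:) (rule subspaceI; simp add: lin zero inner_add_right)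
qed

text \<open>
  Point-line and bar-joint frameworks are compared in homogeneous coordinates: a point \<open>p\<close>
  becomes \<open>(p, 1)\<close> and a line with normal \<open>a\<close> becomes the point \<open>(a, 0)\<close> at infinity. The shear
  with parameter \<open>\<alpha>\<close> moves all these vectors off the plane at infinity, and the points at infinity
  land on the line \<open>\<alpha> \<bullet> x = 1\<close>. Motions transform contragrediently.
\<close>

lemma point_line_imp_bar_joint:
  fixes E :: "'v::finite set set"
  assumes sg: "simple_graph E" and fw: "point_line_framework X E p l"
    and rigid: "point_line_inf_rigid X E p l"
  shows "\<exists>P :: 'v \<Rightarrow> real^2. bar_joint_inf_rigid E P \<and> collinear (P ` X)"
proof -
  define u where "u i = (if i \<in> X then fst (l i) else p i)" for i
  define h :: "'v \<Rightarrow> real" where "h i = (if i \<in> X then 0 else 1)" for i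
  have "(u i, h i) \<noteq> 0" for i
    using fw by (auto simp: u_def h_def point_line_framework_def mem_Times_iff zero_prod_def)
  then obtain \<alpha> where \<alpha>: "\<And>i. \<alpha> \<bullet> u i + h i \<noteq> 0"
    using exists_projective_direction[of "\<lambda>i. (u i, h i)"] by auto
  define s where "s i = \<alpha> \<bullet> u i + h i" for i
  have s0: "s i \<noteq> 0" for i using \<alpha> by (simp add: s_def)
  define P where "P i = (1 / s i) *\<^sub>R u i" for i
  have uP: "u i = s i *\<^sub>R P i" for i by (simp add: P_def s0)
  have aP: "\<alpha> \<bullet> P i * s i = s i - h i" for i using s0[of i] 
    by (simp add: P_def) (simp add: s_def)
  let ?Z = "point_line_motions X E p l"
  have unit: "i \<in> X \<Longrightarrow> fst (l i) \<bullet> fst (l i) = 1" for i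
    using fw by (auto simp: point_line_framework_def mem_Times_iff dot_square_norm)
  \<comment> \<open>The pair \<open>(v, w)\<close> is the velocity dual to the homogeneous vector
    \<open>(u, h)\<close>. For a point, \<open>w\<close> is chosen to make
    \<open>u \<bullet> v + h * w = 0\<close>; for a line this is the condition on the normal. All
    three kinds of edges then satisfy one symmetric bilinear equation.\<close>
  define v where "v = (\<lambda>(p', a', r' :: real^'v) i. if i \<in> X then a' $ i else (p' $ i :: real^2))"
  define w where "w = (\<lambda>(p' :: real^2^'v, a' :: real^2^'v, r' :: real^'v) i.
      if i \<in> X then r' $ i else - (p i \<bullet> p' $ i))"
  have Z_iff: "z \<in> ?Z \<longleftrightarrow> (\<forall>i\<in>X. fst z $ i = 0) \<and> (\<forall>j. j \<notin> X \<longrightarrow> fst (snd z) $ j = 0 \<and> snd (snd z) $ j = 0)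
      \<and> (\<forall>i. u i \<bullet> v z i + h i * w z i = 0)
      \<and> (\<forall>i j. {i, j} \<in> E \<longrightarrow> u i \<bullet> v z j + h i * w z j + u j \<bullet> v z i + h j * w z i = 0)" for z
  proof -
    obtain p' a' r' where z: "z = (p', a', r')" by (cases z) auto
    have eq: "(\<forall>i j. {i, j} \<in> E \<longrightarrow> u i \<bullet> v z j + h i * w z j + u j \<bullet> v z i + h j * w z i = 0) \<longleftrightarrow>
       (\<forall>i j. {i, j} \<in> E \<and> i \<notin> X \<and> j \<notin> X \<longrightarrow> (p i - p j) \<bullet> (p' $ i - p' $ j) = 0) \<and>
        (\<forall>i j. {i, j} \<in> E \<and> i \<notin> X \<and> j \<in> X \<longrightarrow>
           p i \<bullet> (a' $ j) + (p' $ i) \<bullet> fst (l j) + r' $ j = 0) \<and>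
        (\<forall>i j. {i, j} \<in> E \<and> i \<in> X \<and> j \<in> X \<longrightarrow>
           fst (l i) \<bullet> (a' $ j) + (a' $ i) \<bullet> fst (l j) = 0)" (is "?L \<longleftrightarrow> ?R")
    proof -
      let ?Q = "\<lambda>i j. u i \<bullet> v z j + h i * w z j + u j \<bullet> v z i + h j * w z i = 0"
      have PP: "?Q i j \<longleftrightarrow> (p i - p j) \<bullet> (p' $ i - p' $ j) = 0" if "i \<notin> X" "j \<notin> X" for i j
        using that by (simp add: u_def v_def w_def h_def z inner_diff_left inner_diff_right) argo
      have PL: "?Q i j \<longleftrightarrow> p i \<bullet> (a' $ j) + (p' $ i) \<bullet> fst (l j) + r' $ j = 0" 
        if "i \<notin> X" "j \<in> X" for i j
        using that by (simp add: u_def v_def w_def h_def z inner_commute) argo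
      have LL: "?Q i j \<longleftrightarrow> fst (l i) \<bullet> (a' $ j) + (a' $ i) \<bullet> fst (l j) = 0" 
        if "i \<in> X" "j \<in> X" for i j
        using that by (simp add: u_def v_def w_def h_def z inner_commute) 
      have sym: "?Q i j \<longleftrightarrow> ?Q j i" for i j by (simp add: algebra_simps)
      show ?thesis
      proof
        assume L: ?L
        show ?R
          using L[rule_format] PP[THEN iffD1] PL[THEN iffD1] LL[THEN iffD1] by simp
      next
        assume R: ?R
        show ?L
        proof (intro allI impI)
          fix i j assume ij: "{i, j} \<in> E"
          then have ji: "{j, i} \<in> E" by (simp add: insert_commute)
          consider "i \<notin> X" "j \<notin> X" | "i \<notin> X" "j \<in> X" | "i \<in> X" "j \<notin> X" | "i \<in> X" "j \<in> X"
            by blast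
          then show "?Q i j"
          proof cases
            case 1
            then show ?thesis using PP[of i j] R ij by simp
          next
            case 3
            then have "?Q j i" using PL[of j i] R ji by simp
            then show ?thesis using sym[of i j] by simp
          qed (use PL[of i j] LL[of i j] R ij in simp)+
        qed
      qed
    qed
    have eq2: "(\<forall>i. u i \<bullet> v z i + h i * w z i = 0) \<longleftrightarrow> (\<forall>i\<in>X. fst (l i) \<bullet> (a' $ i) = 0)"
      by (auto simp: u_def v_def w_def h_def z)
    show ?thesis unfolding eq eq2 unfolding z point_line_motions_def by auto
  qed
  \<comment> \<open>The shear maps \<open>(u, h)\<close> to \<open>(u, s)\<close>, and its inverse
    transpose maps \<open>(v, w)\<close> to \<open>(v - w *\<^sub>R \<alpha>, w)\<close>. Division
    by \<open>s\<close> then gives the velocity of \<open>P i\<close>; \<open>V\<close> and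
    \<open>W\<close> undo both steps.\<close>
  define F :: "_ \<Rightarrow> real^2^'v" where "F z = (\<chi> i. (1 / s i) *\<^sub>R (v z i - w z i *\<^sub>R \<alpha>))" for z
  define V where "V x i = s i *\<^sub>R (x $ i - (P i \<bullet> x $ i) *\<^sub>R \<alpha>)" for x :: "real^2^'v" and i
  define W where "W x i = - s i * (P i \<bullet> x $ i)" for x :: "real^2^'v" and i
  define G where "G x = ((\<chi> i. if i \<in> X then 0 else V x i) :: real^2^'v, 
     (\<chi> i. if i \<in> X then V x i else 0) :: real^2^'v, (\<chi> i. if i \<in> X then W x i else 0) :: real^'v)" for x
  have linv: "v (z + z') i = v z i + v z' i" "v (c *\<^sub>R z) i = c *\<^sub>R v z i"
             "w (z + z') i = w z i + w z' i" "w (c *\<^sub>R z) i = c *\<^sub>R w z i" for z z' c i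
    by (auto simp: v_def w_def inner_add_right split: prod.splits)
  have linF: "linear F"
    by (rule linearI) (auto simp: F_def linv vec_eq_iff algebra_simps)
  have linV: "V (x + y) i = V x i + V y i" "V (c *\<^sub>R x) i = c *\<^sub>R V x i"
             "W (x + y) i = W x i + W y i" "W (c *\<^sub>R x) i = c *\<^sub>R W x i" for x y c i
    by (auto simp: V_def W_def inner_add_right algebra_simps)
  have linG: "linear G"
    by (rule linearI) (auto simp: G_def linV vec_eq_iff)
  have id: "u i \<bullet> V x i + h i * W x i = 0" for x i
  proof -
    have "u i \<bullet> V x i + h i * W x i = s i * (P i \<bullet> x $ i) * (s i - \<alpha> \<bullet> P i * s i - h i)"
      unfolding V_def W_def by (simp add: uP inner_diff_right algebra_simps inner_commute)
    then show ?thesis using aP[of i] by simp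
  qed
  have vG: "v (G x) i = V x i" "w (G x) i = W x i" for x i
  proof -
    show "v (G x) i = V x i" by (simp add: v_def G_def)
    show "w (G x) i = W x i"
      using id[of i x] by (cases "i \<in> X") (simp_all add: w_def G_def u_def h_def)
  qed
  \<comment> \<open>The homogeneous edge equation is the bar-joint equation up to the nonzero factor
    \<open>- s i * s j\<close>.\<close>
  have pair: "u i \<bullet> V x j + h i * W x j + u j \<bullet> V x i + h j * W x i
      = - s i * s j * ((P i - P j) \<bullet> (x $ i - x $ j))" for x i j
  proof -
    have "u i \<bullet> V x j + h i * W x j + u j \<bullet> V x i + h j * W x i
      = s i * s j * (P i \<bullet> x $ j + P j \<bullet> x $ i) 
        - s j * (P j \<bullet> x $ j) * (\<alpha> \<bullet> P i * s i + h i) - s i * (P i \<bullet> x $ i) * (\<alpha> \<bullet> P j * s j + h j)"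
      unfolding V_def W_def by (simp add: uP inner_diff_right algebra_simps inner_commute)
    also have "\<alpha> \<bullet> P i * s i + h i = s i" using aP[of i] by simp
    also have "\<alpha> \<bullet> P j * s j + h j = s j" using aP[of j] by simp
    finally show ?thesis
      by (simp add: inner_diff_left inner_diff_right algebra_simps)
  qed
  have VF: "V (F z) i = v z i \<and> W (F z) i = w z i" if "u i \<bullet> v z i + h i * w z i = 0" for z i
  proof -
    have "s i * (P i \<bullet> F z $ i) * s i = u i \<bullet> (v z i - w z i *\<^sub>R \<alpha>)"
      using s0[of i] by (simp add: uP F_def)
    also have "\<dots> = - h i * w z i - w z i * (\<alpha> \<bullet> u i)"
      using that by (simp add: inner_diff_right inner_commute)
    also have "\<dots> = - w z i * s i" by (simp add: s_def algebra_simps)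
    finally have *: "s i * (P i \<bullet> F z $ i) = - w z i"
      using s0[of i] by (metis mult_cancel_right)
    then have "V (F z) i = s i *\<^sub>R F z $ i + w z i *\<^sub>R \<alpha>"
      unfolding V_def by (simp add: scaleR_diff_right)
    also have "\<dots> = v z i" using s0[of i] by (simp add: F_def)
    finally show ?thesis unfolding W_def using * by simp
  qed
  have "dim ?Z = dim (bar_joint_motions E P)"
  proof (rule antisym)
    have "inj_on F ?Z"
    proof (rule inj_onI)
      fix z z' assume *: "z \<in> ?Z" "z' \<in> ?Z" "F z = F z'"
      have vw: "v z i = v z' i" "w z i = w z' i" for i
        using VF[of i z] VF[of i z'] * unfolding Z_iff by metis+
      have "fst z $ i = fst z' $ i \<and> fst (snd z) $ i = fst (snd z') $ i
          \<and> snd (snd z) $ i = snd (snd z') $ i" for i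
      proof (cases "i \<in> X")
        case True
        then show ?thesis
          using vw[of i] *(1,2)[unfolded Z_iff] by (simp add: v_def w_def case_prod_beta)
      next
        case False
        then show ?thesis
          using vw(1)[of i] *(1,2)[unfolded Z_iff] by (simp add: v_def case_prod_beta)
      qed
      then show "z = z'" by (simp add: prod_eq_iff vec_eq_iff)
    qed
    moreover have "F ` ?Z \<subseteq> bar_joint_motions E P"
    proof safe
      fix z assume z: "z \<in> ?Z"
      have "(P i - P j) \<bullet> (F z $ i - F z $ j) = 0" if "{i, j} \<in> E" for i j
      proof -
        have "V (F z) i = v z i \<and> W (F z) i = w z i" for i
          using VF z unfolding Z_iff by blast
        then have "- s i * s j * ((P i - P j) \<bullet> (F z $ i - F z $ j)) = 0"
          unfolding pair[symmetric] using z that unfolding Z_iff by simp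
        then show ?thesis using s0 by simp
      qed
      then show "F z \<in> bar_joint_motions E P" by (simp add: bar_joint_motions_def)
    qed
    ultimately show "dim ?Z \<le> dim (bar_joint_motions E P)"
      by (rule dim_le_linear_inj_on[OF linF subspace_point_line_motions])
  next
    have GZ: "G x \<in> ?Z" if "x \<in> bar_joint_motions E P" for x
      unfolding Z_iff vG id pair using that by (simp add: G_def bar_joint_motions_def)
    have "inj G"
    proof (rule injI)
      fix x y assume "G x = G y"
      then have *: "V x i = V y i" "W x i = W y i" for i by (metis vG)+
      have "x $ i = y $ i" for i
        using *[of i] s0[of i] unfolding V_def W_def by simp
      then show "x = y" by (simp add: vec_eq_iff)
    qed
    then have "inj_on G (bar_joint_motions E P)" by (rule inj_on_subset) simp
    then show "dim (bar_joint_motions E P) \<le> dim ?Z"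
      using GZ by (intro dim_le_linear_inj_on[OF linG subspace_bar_joint_motions]) auto
  qed
  then have "bar_joint_inf_rigid E P"
    using rigid by (simp add: bar_joint_inf_rigid_def point_line_inf_rigid_def)
  moreover have "collinear (P ` X)"
  proof -
    have on: "\<alpha> \<bullet> P i = 1" if "i \<in> X" for i
      using aP[of i] s0[of i] that by (simp add: h_def)
    show ?thesis
    proof (cases "X = {}")
      case False
      then have "\<alpha> \<noteq> 0" using on by force
      then show ?thesis by (rule collinear_if_inner_const[where d = 1]) (use on in auto)
    qed simp
  qed
  ultimately show ?thesis by blast
qed

section \<open>Rank bounds for bar-joint frameworks\<close>

lemma nu_eq: "nu Y A = card (Y \<inter> \<Union>A)"
  unfolding nu_def by (rule arg_cong[where f = card]) auto

text \<open>The entry at \<open>k\<close> of an edge with other end \<open>j\<close> is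
  \<open>f k j\<close>. Wherever this is used, \<open>f k k = 0\<close>, so the sum over
  \<open>e\<close> selects the other end without orienting the edge.\<close>

definition edge_row :: "('v::finite \<Rightarrow> 'v \<Rightarrow> real^2) \<Rightarrow> 'v set \<Rightarrow> real^2^'v" where
  "edge_row f e = (\<chi> k. if k \<in> e then (\<Sum>j\<in>e. f k j) else 0)"

lemma inner_edge_row:
  assumes "i \<noteq> j" "\<And>k. f k k = 0"
  shows "edge_row f {i, j} \<bullet> z = f i j \<bullet> z $ i + f j i \<bullet> z $ j"
proof -
  have "edge_row f {i, j} \<bullet> z = (\<Sum>k\<in>{i, j}. edge_row f {i, j} $ k \<bullet> z $ k)"
    unfolding inner_vec_def[of _ z] by (rule sum.mono_neutral_right) (auto simp: edge_row_def)
  then show ?thesis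
    using assms by (simp add: edge_row_def)
qed

definition bar_row :: "('v::finite \<Rightarrow> real^2) \<Rightarrow> 'v set \<Rightarrow> real^2^'v" where
  "bar_row p = edge_row (\<lambda>k j. p k - p j)"

lemma inner_bar_row:
  assumes "i \<noteq> j"
  shows "bar_row p {i, j} \<bullet> z = (p i - p j) \<bullet> (z $ i - z $ j)"
  using assms by (simp add: bar_row_def inner_edge_row inner_diff_left inner_diff_right)

lemma bar_joint_motions_eq_orthogonal:
  assumes "simple_graph E"
  shows "bar_joint_motions E p = {z. \<forall>x\<in>bar_row p ` E. x \<bullet> z = 0}"
proof -
  have "(\<forall>i j. {i, j} \<in> E \<longrightarrow> (p i - p j) \<bullet> (z $ i - z $ j) = 0) \<longleftrightarrow> (\<forall>e\<in>E. bar_row p e \<bullet> z = 0)" for z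
  proof
    assume L: "\<forall>i j. {i, j} \<in> E \<longrightarrow> (p i - p j) \<bullet> (z $ i - z $ j) = 0"
    show "\<forall>e\<in>E. bar_row p e \<bullet> z = 0"
    proof
      fix e assume e: "e \<in> E"
      then obtain i j where "e = {i, j}" "i \<noteq> j"
        using assms by (auto simp: simple_graph_def card_2_iff)
      then show "bar_row p e \<bullet> z = 0" using L e inner_bar_row by metis
    qed
  next
    assume R: "\<forall>e\<in>E. bar_row p e \<bullet> z = 0"
    show "\<forall>i j. {i, j} \<in> E \<longrightarrow> (p i - p j) \<bullet> (z $ i - z $ j) = 0"
    proof (intro allI impI)
      fix i j assume ij: "{i, j} \<in> E"
      show "(p i - p j) \<bullet> (z $ i - z $ j) = 0"
        using R ij inner_bar_row[of i j p z] by (cases "i = j") auto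
    qed
  qed
  then show ?thesis by (simp add: bar_joint_motions_def)
qed

text \<open>
  Split off the velocity components along the line carrying \<open>X\<close>. For the remaining components
  the rows of a single block are annihilated by the translation normal to the line and by the
  rotation about a point of the line; for the components along the line all rows are annihilated
  by the translation along the line.
\<close>

lemma collinear_rank_bound:
  fixes p :: "'v::finite \<Rightarrow> real^2"
  assumes edges: "\<And>e. e \<in> A \<Longrightarrow> card e = 2"
    and indep: "inj_on (bar_row p) A" "independent (bar_row p ` A)"
    and a: "a \<noteq> 0" "\<And>i. i \<in> X \<Longrightarrow> a \<bullet> p i = d"
    and X: "X \<inter> \<Union>A \<noteq> {}" and part: "partition_on A P"
  shows "int (card A) \<le> (\<Sum>B\<in>P. 2 * int (nu (UNIV - X) B) + int (nu X B) - 2) + int (nu X A) - 1"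
proof -
  \<comment> \<open>The orthogonal projection that keeps, at vertices of \<open>X\<close>, only the
    component normal to the line.\<close>
  define \<pi> where "\<pi> z = (\<chi> k. if k \<in> X then ((a \<bullet> z $ k) / (a \<bullet> a)) *\<^sub>R a else z $ k)" for z :: "real^2^'v"
  have lin: "linear \<pi>"
    by (rule linearI) (auto simp: \<pi>_def vec_eq_iff inner_add_right add_divide_distrib algebra_simps)
  have aa: "a \<bullet> a \<noteq> 0" using a by simp
  \<comment> \<open>The point of the line nearest to the origin. A rotation about a point of the
    line moves the vertices of \<open>X\<close> in direction \<open>a\<close>, so
    \<open>\<pi>\<close> leaves it unchanged.\<close>
  define c where "c = (d / (a \<bullet> a)) *\<^sub>R a"
  have ac: "a \<bullet> c = d" using aa by (simp add: c_def)
  let ?W = "span (bar_row p ` A)"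
  have edge: "\<exists>i j. e = {i, j} \<and> i \<noteq> j \<and> p i \<noteq> p j" if e: "e \<in> A" for e
  proof -
    obtain i j where ij: "e = {i, j}" "i \<noteq> j" using edges[OF e] by (auto simp: card_2_iff)
    have "bar_row p e \<noteq> 0" using e indep(2) dependent_zero by (metis imageI)
    moreover have "bar_row p e = 0" if "p i = p j"
      using that ij by (auto simp: bar_row_def edge_row_def vec_eq_iff)
    ultimately show ?thesis using ij by blast
  qed
  have block: "int (dim (\<pi> ` bar_row p ` B)) \<le> 2 * int (nu (UNIV - X) B) + int (nu X B) - 2"
    if BP: "B \<in> P" for B
  proof -
    have BA: "B \<subseteq> A" and Bne: "B \<noteq> {}" using part BP by (auto simp: partition_on_def)
    define D where "D k = (if k \<in> X then {a} else {axis 1 1, axis 2 1})" for k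
    define Q :: "(real^2^'v) set" where "Q = (\<Union>k\<in>\<Union>B. axis k ` D k)"
    define z1 where "z1 = (\<chi> k. if k \<in> \<Union>B then a else 0)"
    define z2 where "z2 = (\<chi> k. if k \<in> \<Union>B then perp (p k - c) else 0)"
    have Q: "z \<in> span Q" if "\<And>k. k \<notin> \<Union>B \<Longrightarrow> z $ k = 0" "\<And>k. k \<in> X \<Longrightarrow> z $ k \<in> span {a}" for z
      unfolding Q_def
    proof (rule vec_in_span_axes)
      fix k show "z $ k \<in> span (D k)" using that(2) span_axes_real2 by (simp add: D_def)
    qed (use that in auto)
    have perpX: "perp (p k - c) \<in> span {a}" if "k \<in> X" for k
    proof -
      have "a \<bullet> (p k - c) = 0" using a(2)[OF that] ac by (simp add: inner_diff_right)
      then obtain r where "p k - c = r *\<^sub>R perp a"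
        using inner_eq_0_imp_perp_multiple[OF a(1)] by metis
      then have "perp (p k - c) = (- r) *\<^sub>R a" by simp
      then show ?thesis by (metis span_base span_scale insertI1)
    qed
    have TQ: "{z1, z2} \<subseteq> span Q"
      using perpX by (intro insert_subsetI empty_subsetI Q)
        (auto simp: z1_def z2_def span_base span_zero)
    have suppB: "bar_row p e $ k = 0" if "e \<in> B" "k \<notin> \<Union>B" for e k
      using that by (auto simp: bar_row_def edge_row_def)
    have "\<pi> (bar_row p e) \<in> span Q" if e: "e \<in> B" for e
    proof (rule Q)
      show "\<pi> (bar_row p e) $ k = 0" if "k \<notin> \<Union>B" for k
        using suppB[OF e that] by (simp add: \<pi>_def)
      show "\<pi> (bar_row p e) $ k \<in> span {a}" if "k \<in> X" for k
        using that by (simp add: \<pi>_def span_scale span_base)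
    qed
    then have RQ: "\<pi> ` bar_row p ` B \<subseteq> span Q" by blast
    have orth: "x \<bullet> t = 0" if x: "x \<in> \<pi> ` bar_row p ` B" and t: "t \<in> {z1, z2}" for x t
    proof -
      obtain e where e: "e \<in> B" "x = \<pi> (bar_row p e)" using x by blast
      have tX: "t $ k \<in> span {a}" if "k \<in> X" for k
        using t perpX[OF that] by (auto simp: z1_def z2_def span_base span_zero)
      have "\<pi> (bar_row p e) $ k \<bullet> t $ k = bar_row p e $ k \<bullet> t $ k" for k
      proof (cases "k \<in> X")
        case True
        then obtain r where "t $ k = r *\<^sub>R a"
          using tX[OF True] unfolding span_singleton by blast
        then show ?thesis using aa True by (simp add: \<pi>_def inner_commute)
      qed (simp add: \<pi>_def)
      then have "x \<bullet> t = bar_row p e \<bullet> t"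
        unfolding e(2) inner_vec_def[of _ t] by (intro sum.cong refl)
      moreover obtain i j where ij: "e = {i, j}" "i \<noteq> j"
        using edge[OF subsetD[OF BA e(1)]] by blast
      ultimately have "x \<bullet> t = (p i - p j) \<bullet> (t $ i - t $ j)"
        using inner_bar_row[OF ij(2)] by metis
      also have "\<dots> = 0"
      proof -
        have "t $ i - t $ j = 0 \<or> t $ i - t $ j = perp (p i - p j)"
          using t subsetD[OF Union_upper[OF e(1)], unfolded ij(1)] by (elim insertE) (simp_all add: z1_def z2_def)
        then show ?thesis by (metis inner_perp_self(1) inner_zero_right)
      qed
      finally show ?thesis .
    qed
    \<comment> \<open>The ends of an edge have distinct positions because its row is nonzero. The
      translation \<open>z1\<close> agrees at both ends, the rotation \<open>z2\<close> does
      not.\<close>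
    have "dim {z1, z2} = 2"
    proof -
      obtain e i j where e: "e \<in> B" and ij: "e = {i, j}" "p i \<noteq> p j"
        using edge subsetD[OF BA] Bne by (metis all_not_in_conv)
      then have V: "i \<in> \<Union>B" "j \<in> \<Union>B" by auto
      have "z1 $ i = a" using V by (simp add: z1_def)
      then have "z1 \<noteq> 0" using a(1) by auto
      moreover have "z2 \<notin> span {z1}"
      proof
        assume "z2 \<in> span {z1}"
        then obtain r where r: "z2 = r *\<^sub>R z1" by (auto simp: span_singleton)
        have "z2 $ i = z2 $ j" using V by (simp add: r z1_def)
        then have "perp (p i - p j) = 0" using V by (simp add: z2_def)
        then show False using ij by (simp del: perp_diff)
      qed
      ultimately show ?thesis by (simp add: dim_insert insert_commute[of z1 z2])
    qed
    moreover have "dim (\<pi> ` bar_row p ` B) + dim {z1, z2} \<le> card Q"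
      by (rule dim_plus_dim_orthogonal_le[OF RQ TQ _ orth]) (auto simp: Q_def D_def)
    moreover have "card Q \<le> 2 * nu (UNIV - X) B + nu X B"
    proof -
      have "card Q \<le> (\<Sum>k\<in>\<Union>B. card (D k))"
        unfolding Q_def by (rule card_UN_axes_le) (simp add: D_def)
      also have "\<dots> = (\<Sum>k\<in>\<Union>B. if k \<in> X then 1 else 2)"
        by (intro sum.cong) (auto simp: D_def card_axes_real2 simp del: axis_eq_axis)
      also have "\<dots> = card (X \<inter> \<Union>B) + 2 * card ((UNIV - X) \<inter> \<Union>B)"
        by (simp add: sum.If_cases Int_commute Compl_eq_Diff_UNIV)
      finally show ?thesis by (simp add: nu_eq)
    qed
    ultimately show ?thesis by linarith
  qed
  have ker: "dim {x \<in> ?W. \<pi> x = 0} + 1 \<le> nu X A"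
  proof -
    \<comment> \<open>The translation along the line, cut off outside
      \<open>X \<inter> \<Union>A\<close>. Vectors of the kernel vanish there, so they remain
      orthogonal to it.\<close>
    define z where "z = (\<chi> k. if k \<in> X \<inter> \<Union>A then perp a else 0)"
    define Q :: "(real^2^'v) set" where "Q = (\<Union>k\<in>X \<inter> \<Union>A. axis k ` {perp a})"
    have Q: "x \<in> span Q" if "\<And>k. k \<notin> X \<inter> \<Union>A \<Longrightarrow> x $ k = 0" "\<And>k. x $ k \<in> span {perp a}" for x
      unfolding Q_def by (rule vec_in_span_axes) (use that in auto)
    have supp: "x $ k = 0" if "x \<in> ?W" "k \<notin> \<Union>A" for x k
      using that(1)
    proof (induction rule: span_induct_alt)
      case (step c x y)
      then show ?case using that(2) by (auto simp: bar_row_def edge_row_def)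
    qed simp
    have tr: "x \<bullet> (\<chi> k. perp a) = 0" if "x \<in> ?W" for x
      using that
    proof (induction rule: span_induct_alt)
      case (step r x y)
      then obtain e where "e \<in> A" "x = bar_row p e" by blast
      then obtain i j where "x = bar_row p {i, j}" "i \<noteq> j" using edge by blast
      then show ?case using step by (simp add: inner_add_left inner_bar_row)
    qed simp
    have kerx: "x $ k \<in> span {perp a}" "k \<notin> X \<Longrightarrow> x $ k = 0" if "\<pi> x = 0" for x k
    proof -
      have 0: "\<pi> x $ k = 0" using that by simp
      show "k \<notin> X \<Longrightarrow> x $ k = 0" using 0 by (simp add: \<pi>_def)
      show "x $ k \<in> span {perp a}"
      proof (cases "k \<in> X")
        case True
        then have "a \<bullet> x $ k = 0" using 0 a(1) aa by (simp add: \<pi>_def)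
        then obtain r where "x $ k = r *\<^sub>R perp a"
          using inner_eq_0_imp_perp_multiple[OF a(1)] by metis
        then show ?thesis by (metis span_base span_scale insertI1)
      qed (use 0 in \<open>simp add: \<pi>_def span_zero\<close>)
    qed
    have "dim {x \<in> ?W. \<pi> x = 0} + dim {z} \<le> card Q"
    proof (rule dim_plus_dim_orthogonal_le)
      show "{x \<in> ?W. \<pi> x = 0} \<subseteq> span Q"
      proof
        fix x assume x: "x \<in> {x \<in> ?W. \<pi> x = 0}"
        show "x \<in> span Q"
          by (rule Q) (use x supp[of x] kerx[of x] in blast)+
      qed
      have "z \<in> span Q" by (rule Q) (auto simp: z_def span_base span_zero)
      then show "{z} \<subseteq> span Q" by simp
      show "finite Q" by (simp add: Q_def)
      fix x t assume x: "x \<in> {x \<in> ?W. \<pi> x = 0}" and t: "t \<in> {z}"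
      have "x $ k \<bullet> z $ k = x $ k \<bullet> (\<chi> k. perp a) $ k" for k
        using x supp[of x k] kerx(2)[of x k] by (auto simp: z_def)
      then have "x \<bullet> z = x \<bullet> (\<chi> k. perp a)" by (simp add: inner_vec_def[where 'b='v])
      then show "x \<bullet> t = 0" using tr x t by simp
    qed
    moreover have "z \<noteq> 0"
    proof -
      obtain k where "k \<in> X \<inter> \<Union>A" using X by blast
      then have "z $ k = perp a" by (simp add: z_def)
      then show ?thesis using a(1) by auto
    qed
    moreover have "card Q \<le> nu X A"
    proof -
      have "card Q \<le> (\<Sum>k\<in>X \<inter> \<Union>A. card {perp a})"
        unfolding Q_def by (rule card_UN_axes_le) simp
      then show ?thesis by (simp add: nu_eq)
    qed
    ultimately show ?thesis by simp
  qed
  have "dim ?W = card A" using indep by (simp add: dim_eq_card_independent card_image)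
  moreover have "dim ?W \<le> dim (\<pi> ` ?W) + dim {x \<in> ?W. \<pi> x = 0}"
    by (rule dim_le_dim_image_plus_kernel[OF lin]) simp
  moreover have "dim (\<pi> ` ?W) \<le> (\<Sum>B\<in>P. dim (\<pi> ` bar_row p ` B))"
  proof -
    have "\<pi> ` ?W = span (\<pi> ` bar_row p ` A)" using linear_span_image[OF lin] by simp
    then have "dim (\<pi> ` ?W) = dim (\<pi> ` bar_row p ` A)" by simp
    also have "\<pi> ` bar_row p ` A = (\<Union>B\<in>P. \<pi> ` bar_row p ` B)"
      using part by (auto simp: partition_on_def)
    finally show ?thesis using dim_UN_le[of P "\<lambda>B. \<pi> ` bar_row p ` B"] by simp
  qed
  moreover have "int (\<Sum>B\<in>P. dim (\<pi> ` bar_row p ` B))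
      \<le> (\<Sum>B\<in>P. 2 * int (nu (UNIV - X) B) + int (nu X B) - 2)"
    unfolding of_nat_sum by (intro sum_mono block)
  ultimately show ?thesis using ker by linarith
qed

text \<open>The edges of \<open>E'\<close> index a basis of the row space of \<open>E\<close>, whose
  dimension is \<open>2 * CARD('v) - 3\<close> by rank-nullity.\<close>

lemma bar_joint_imp_count:
  fixes E :: "'v::finite set set"
  assumes sg: "simple_graph E" and rigid: "bar_joint_inf_rigid E p" and col: "collinear (p ` X)"
  shows "\<exists>E' \<subseteq> E. int (card E') = 2 * int (card (UNIV :: 'v set)) - 3 \<and>
              (\<forall>A \<subseteq> E'. A \<noteq> {} \<longrightarrow> (\<forall>P. partition_on A P \<longrightarrow>
                 int (card A) \<le>
                   (\<Sum>B\<in>P. 2 * int (nu (UNIV - X) B) + int (nu X B) - 2) + int (nu X A) - 1))"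
proof -
  obtain S where S: "S \<subseteq> bar_row p ` E" "independent S" "card S = dim (bar_row p ` E)"
    using basis_exists[of "bar_row p ` E"] by metis
  then obtain E' where E': "E' \<subseteq> E" "inj_on (bar_row p) E'" "S = bar_row p ` E'"
    using subset_image_inj[of S "bar_row p" E] by metis
  have "dim (bar_joint_motions E p) + dim (bar_row p ` E) = 2 * CARD('v)"
    unfolding bar_joint_motions_eq_orthogonal[OF sg]
    using dim_orthogonal_complement[of "bar_row p ` E"] by simp
  then have card: "int (card E') = 2 * int (card (UNIV :: 'v set)) - 3"
    using rigid S E' by (simp add: bar_joint_inf_rigid_def card_image)
  obtain a d where a: "a \<noteq> 0" "\<And>x. x \<in> p ` X \<Longrightarrow> a \<bullet> x = d"
    using collinear_imp_inner_const[OF col] by blast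
  have count: "int (card A) \<le>
      (\<Sum>B\<in>P. 2 * int (nu (UNIV - X) B) + int (nu X B) - 2) + int (nu X A) - 1"
    if A: "A \<subseteq> E'" "A \<noteq> {}" and P: "partition_on A P" for A P
  proof -
    have edges: "card e = 2" if "e \<in> A" for e
      using that A(1) E'(1) sg by (auto simp: simple_graph_def)
    have inj: "inj_on (bar_row p) A" using E'(2) A(1) inj_on_subset by blast
    have ind: "independent (bar_row p ` A)"
      using S(2) A(1) unfolding E'(3) by (meson image_mono independent_mono)
    show ?thesis
    proof (cases "X \<inter> \<Union>A = {}")
      case False
      then show ?thesis using a by (intro collinear_rank_bound[OF edges inj ind a(1) _ _ P]) auto
    next
      \<comment> \<open>If \<open>A\<close> misses \<open>X\<close>, the rank bound is applied to a
        single vertex \<open>k\<close> of \<open>A\<close> and a line through it instead. The block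
        containing \<open>k\<close> lowers the sum by at least 1, which pays for
        \<open>nu {k} A \<le> 1\<close>.\<close>
      case True
      obtain e where e: "e \<in> A" using A(2) by blast
      then obtain k where k: "k \<in> e" using edges[of e] by fastforce
      let ?f = "\<lambda>Y B. 2 * int (nu (UNIV - Y) B) + int (nu Y B) - 2"
      have "int (card A) \<le> (\<Sum>B\<in>P. ?f {k} B) + int (nu {k} A) - 1"
        using e k by (intro collinear_rank_bound[OF edges inj ind _ _ _ P, of "axis 1 1" _ "axis 1 1 \<bullet> p k"]) auto
      moreover have "nu {k} A \<le> 1" unfolding nu_eq by (rule order_trans[OF card_mono[of "{k}"]]) auto
      moreover have "(\<Sum>B\<in>P. ?f {k} B) < (\<Sum>B\<in>P. ?f X B)"
      proof (rule sum_strict_mono_ex1)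
        show "finite P" by simp
        have fX: "?f X B = 2 * int (card (\<Union>B)) - 2" if "B \<in> P" for B
        proof -
          have "X \<inter> \<Union>B = {}" using True P that by (auto simp: partition_on_def)
          moreover from this have "(UNIV - X) \<inter> \<Union>B = \<Union>B" by blast
          ultimately show ?thesis by (simp add: nu_eq)
        qed
        have fk: "?f {k} B = 2 * int (card (\<Union>B)) - (if k \<in> \<Union>B then 1 else 0) - 2" for B
        proof (cases "k \<in> \<Union>B")
          case True
          then have "card (\<Union>B - {k}) + 1 = card (\<Union>B)"
            by (metis Suc_eq_plus1 card_Suc_Diff1 finite)
          moreover have "(UNIV - {k}) \<inter> \<Union>B = \<Union>B - {k}" "{k} \<inter> \<Union>B = {k}" using True by blast+
          ultimately show ?thesis using True by (simp add: nu_eq)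
        next
          case False
          then have "(UNIV - {k}) \<inter> \<Union>B = \<Union>B" "{k} \<inter> \<Union>B = {}" by blast+
          then show ?thesis using False by (simp add: nu_eq)
        qed
        show "\<forall>B\<in>P. ?f {k} B \<le> ?f X B" unfolding fk using fX by simp
        obtain B where "B \<in> P" "e \<in> B" using P e by (auto simp: partition_on_def)
        then have "B \<in> P" "k \<in> \<Union>B" using k by auto
        then show "\<exists>B\<in>P. ?f {k} B < ?f X B"
          unfolding fk using fX by (intro bexI[of _ B]) simp_all
      qed
      moreover have "nu X A = 0" using True by (simp add: nu_eq)
      ultimately show ?thesis by linarith
    qed
  qed
  show ?thesis using E'(1) card count by blast
qed

section \<open>Generic point-line frameworks\<close>

text \<open>
  The parameters \<open>g $ i\<close> are the position of a point \<open>i\<close> and a normal, not necessarily of length 1,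
  of a line \<open>i\<close>. In a motion \<open>z\<close> the vector \<open>z $ i\<close> is the velocity of a point \<open>i\<close>, but for a line
  \<open>i\<close> its two coordinates are the angular velocity and the velocity of the offset. The index \<open>None\<close>
  selects the row of the framework. The rows indexed by \<open>Some False\<close> and \<open>Some True\<close> form the system
  without rotations: the angular velocities of the lines are dropped, and the two rows of a
  point-point edge force its ends to move with equal velocities.
\<close>

definition entry :: "bool option \<Rightarrow> 'v set \<Rightarrow> real^2^'v \<Rightarrow> 'v::finite \<Rightarrow> 'v \<Rightarrow> real^2" where
  "entry m X g k j =
    (if k \<in> X then (if m = None then g $ j \<bullet> perp (g $ k) else 0) *\<^sub>R axis 1 1 + (if j \<in> X then 0 else axis 2 1)
     else if j \<in> X then g $ j
     else if m = Some True then perp (g $ k - g $ j)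
     else g $ k - g $ j)"

definition pl_row :: "'v::finite set \<Rightarrow> 'v set \<times> bool option \<Rightarrow> real^2^'v \<Rightarrow> real^2^'v" where
  "pl_row X s g = edge_row (entry (snd s) X g) (fst s)"

lemma entry_self [simp]: "entry m X g k k = 0"
  by (simp add: entry_def)

lemma inner_pl_row:
  assumes "i \<noteq> j"
  shows "pl_row X ({i, j}, m) g \<bullet> z = entry m X g i j \<bullet> z $ i + entry m X g j i \<bullet> z $ j"
  using assms by (simp add: pl_row_def inner_edge_row)

lemma pl_row_nth:
  assumes "i \<noteq> j"
  shows "pl_row X ({i, j}, m) g $ k = (if k = i then entry m X g i j else if k = j then entry m X g j i else 0)"
  using assms by (simp add: pl_row_def edge_row_def)

lemma pl_row_nth_eq_0: "k \<notin> fst s \<Longrightarrow> pl_row X s g $ k = 0"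
  by (simp add: pl_row_def edge_row_def)

lemma pl_row_line_component:
  assumes "k \<in> X"
  shows "pl_row X (e, Some b) g $ k $ 1 = 0"
  using assms by (auto simp: pl_row_def edge_row_def entry_def axis_def intro!: sum.neutral)

lemma continuous_on_pl_row: "continuous_on UNIV (pl_row X s)"
proof -
  have "continuous_on UNIV (\<lambda>g. entry m X g k j)" for m k j
    by (cases "k \<in> X"; cases "j \<in> X"; cases "m = None"; cases "m = Some True")
      (auto simp: entry_def simp del: perp_diff intro!: continuous_intros)
  then have "continuous_on UNIV (\<lambda>g. pl_row X s g $ k)" for k
    by (cases "k \<in> fst s") (auto simp: pl_row_def edge_row_def intro!: continuous_intros)
  then show ?thesis using continuous_on_vec_lambda[of UNIV "\<lambda>k g. pl_row X s g $ k"] by simp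
qed

definition entry_deriv :: "bool option \<Rightarrow> 'v set \<Rightarrow> real^2^'v \<Rightarrow> 'v::finite \<Rightarrow> real^2 \<Rightarrow> 'v \<Rightarrow> 'v \<Rightarrow> real^2" where
  "entry_deriv m X g l d k j =
    (if k \<in> X then (if m = None \<and> j = l \<and> j \<notin> X then d \<bullet> perp (g $ k) else 0) *\<^sub>R axis 1 1
     else if j \<in> X then (if j = l then d else 0)
     else (if k = l then d else 0) - (if j = l then d else 0))"

definition pl_row_deriv :: "'v::finite set \<Rightarrow> real^2^'v \<Rightarrow> 'v \<Rightarrow> real^2 \<Rightarrow> 'v set \<times> bool option \<Rightarrow> real^2^'v" where
  "pl_row_deriv X g l d s = edge_row (entry_deriv (snd s) X g l d) (fst s)"

text \<open>The row of a point-line edge is bilinear, so it is only affine along a single coordinate \<open>l\<close>,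
  and \<^const>\<open>pl_row_deriv\<close> is its derivative only if \<open>l\<close> is a point for the rows indexed by \<open>None\<close> and
  a line for the other ones.\<close>

lemma pl_row_line:
  assumes "l \<in> X \<longleftrightarrow> snd s \<noteq> None"
  shows "pl_row X s (g + t *\<^sub>R axis l d) = pl_row X s g + t *\<^sub>R pl_row_deriv X g l d s"
proof -
  have "entry (snd s) X (g + t *\<^sub>R axis l d) k j = entry (snd s) X g k j + t *\<^sub>R entry_deriv (snd s) X g l d k j"
    for k j
    using assms by (auto simp: entry_def entry_deriv_def axis_def algebra_simps)
  then show ?thesis
    by (simp add: pl_row_def pl_row_deriv_def edge_row_def vec_eq_iff sum.distrib sum_distrib_left)
qed

lemma inner_pl_row_deriv:
  assumes "i \<noteq> j"
  shows "pl_row_deriv X g l d ({i, j}, m) \<bullet> z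
    = entry_deriv m X g l d i j \<bullet> z $ i + entry_deriv m X g l d j i \<bullet> z $ j"
  using inner_edge_row[OF assms, of "entry_deriv m X g l d" z]
  by (simp add: pl_row_deriv_def entry_deriv_def)

text \<open>Asked of points too: besides separating the directions of lines it makes all points
  distinct and, given at least two vertices, all normals nonzero.\<close>

definition nonparallel :: "real^2^'v::finite \<Rightarrow> bool" where
  "nonparallel g \<longleftrightarrow> (\<forall>i j. i \<noteq> j \<longrightarrow> g $ i \<bullet> perp (g $ j) \<noteq> 0)"

lemma nonparallel_neq: "nonparallel g \<Longrightarrow> i \<noteq> j \<Longrightarrow> g $ i \<noteq> g $ j"
  unfolding nonparallel_def by (metis inner_perp_self(1))

text \<open>The unit rotation about the origin: it turns every line with angular velocity 1 and
  leaves the offset unchanged.\<close>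

definition rotation :: "'v::finite set \<Rightarrow> real^2^'v \<Rightarrow> real^2^'v" where
  "rotation X g = (\<chi> k. if k \<in> X then axis 1 1 else perp (g $ k))"

text \<open>The scalar \<open>\<omega>\<close> is the angular velocity of the edge.\<close>

lemma edge_angular_velocity:
  assumes e: "card e = 2" and g: "nonparallel g" and z: "pl_row X (e, None) g \<bullet> z = 0"
  shows "\<exists>\<omega>. (\<forall>k\<in>X \<inter> e. z $ k $ 1 = \<omega>)
    \<and> (\<forall>l d. l \<notin> X \<longrightarrow> pl_row_deriv X g l d (e, None) \<bullet> z = \<omega> * (perp (pl_row X (e, None) g $ l) \<bullet> d))
    \<and> (\<forall>b. pl_row X (e, Some b) g \<bullet> (z - \<omega> *\<^sub>R rotation X g) = 0)"
proof -
  obtain i j where ij: "e = {i, j}" "i \<noteq> j" "i \<in> X \<longrightarrow> j \<in> X"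
    using e unfolding card_2_iff by (metis insert_commute)
  note simps = inner_pl_row[OF ij(2)] inner_pl_row_deriv[OF ij(2)] pl_row_nth[OF ij(2)] ij(1)
  consider "i \<notin> X" "j \<notin> X" | "i \<notin> X" "j \<in> X" | "i \<in> X" "j \<in> X" using ij(3) by blast
  then show ?thesis
  proof cases
    case 1
    have "(g $ i - g $ j) \<bullet> (z $ i - z $ j) = 0"
      using z 1 by (simp add: simps entry_def inner_diff_left inner_diff_right)
    moreover have "g $ i - g $ j \<noteq> 0" using nonparallel_neq[OF g ij(2)] by simp
    ultimately obtain \<omega> where \<omega>: "z $ i - z $ j = \<omega> *\<^sub>R perp (g $ i - g $ j)"
      using inner_eq_0_imp_perp_multiple by metis
    have "pl_row_deriv X g l d (e, None) \<bullet> z = \<omega> * (perp (pl_row X (e, None) g $ l) \<bullet> d)" for l d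
    proof -
      have "pl_row_deriv X g l d (e, None) \<bullet> z
          = ((if i = l then d else 0) - (if j = l then d else 0)) \<bullet> (z $ i - z $ j)"
        using 1 by (simp add: simps entry_deriv_def inner_diff_left inner_diff_right)
      then show ?thesis unfolding \<omega> using 1 ij(2)
        by (auto simp: simps entry_def inner_commute inner_diff_left inner_diff_right algebra_simps)
    qed
    moreover have "pl_row X (e, Some b) g \<bullet> (z - \<omega> *\<^sub>R rotation X g) = 0" for b
    proof -
      have "pl_row X (e, Some b) g \<bullet> (z - \<omega> *\<^sub>R rotation X g)
          = entry (Some b) X g i j \<bullet> ((z $ i - z $ j) - \<omega> *\<^sub>R perp (g $ i - g $ j))"
        using 1 by (simp add: simps entry_def rotation_def inner_diff_left inner_diff_right algebra_simps)
      then show ?thesis by (simp add: \<omega>)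
    qed
    ultimately show ?thesis using 1 ij(1) by blast
  next
    case 2
    define \<omega> where "\<omega> = z $ j $ 1"
    have z': "g $ j \<bullet> z $ i + (g $ i \<bullet> perp (g $ j)) * z $ j $ 1 + z $ j $ 2 = 0"
      using z 2 by (simp add: simps entry_def inner_real2 axis_def)
    have "\<forall>k\<in>X \<inter> e. z $ k $ 1 = \<omega>" using 2 ij(1) by (auto simp: \<omega>_def)
    moreover have "pl_row_deriv X g l d (e, None) \<bullet> z = \<omega> * (perp (pl_row X (e, None) g $ l) \<bullet> d)"
      if "l \<notin> X" for l d
      using 2 ij(2) that by (auto simp: simps entry_def entry_deriv_def \<omega>_def inner_real2 axis_def)
    moreover have "pl_row X (e, Some b) g \<bullet> (z - \<omega> *\<^sub>R rotation X g) = 0" for b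
      using z' 2 by (simp add: simps entry_def rotation_def \<omega>_def inner_real2 axis_def algebra_simps)
    ultimately show ?thesis by blast
  next
    case 3
    define \<omega> where "\<omega> = z $ i $ 1"
    \<comment> \<open>Lines that are not parallel keep their angle only if they turn equally
      fast.\<close>
    have "(g $ i \<bullet> perp (g $ j)) * (z $ j $ 1 - z $ i $ 1) = 0"
      using z 3 by (simp add: simps entry_def inner_real2 axis_def algebra_simps)
    then have "z $ j $ 1 = \<omega>" using g ij(2) unfolding nonparallel_def by (simp add: \<omega>_def)
    then have "\<forall>k\<in>X \<inter> e. z $ k $ 1 = \<omega>" using 3 ij(1) by (auto simp: \<omega>_def)
    moreover have "pl_row_deriv X g l d (e, None) \<bullet> z = \<omega> * (perp (pl_row X (e, None) g $ l) \<bullet> d)"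
      if "l \<notin> X" for l d
      using 3 ij(2) that by (auto simp: simps entry_deriv_def)
    moreover have "pl_row X (e, Some b) g \<bullet> (z - \<omega> *\<^sub>R rotation X g) = 0" for b
      using 3 by (simp add: simps entry_def)
    ultimately show ?thesis by blast
  qed
qed

section \<open>Circuits, and tight blocks of the system without rotations\<close>

definition block_rows :: "'v::finite set set \<Rightarrow> ('v set \<times> bool option) set" where
  "block_rows B = B \<times> range Some"

text \<open>Subtracting a multiple of \<open>rotation\<close> takes each motion of \<open>C\<close>
  into the solutions \<open>?K\<close> of the system without rotations whose lines do not turn. So
  the motions have dimension at most \<open>1 + dim ?K\<close>, and \<open>?K\<close> has
  codimension equal to the rank on the left plus \<open>nu X C\<close>. The 1 is absorbed because
  the dependent rows of \<open>C\<close> have rank below \<open>card C\<close>.\<close>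

lemma circuit_rank_bound:
  fixes X :: "'v::finite set"
  assumes edges: "\<And>e. e \<in> C \<Longrightarrow> card e = 2" and g: "nonparallel g"
    and gen: "generic_at (pl_row X) I g" and I: "C \<times> {None} \<subseteq> I"
    and dep: "(\<Sum>e\<in>C. c e *\<^sub>R pl_row X (e, None) g) = 0" "\<And>e. e \<in> C \<Longrightarrow> c e \<noteq> 0"
    and ne: "C \<noteq> {}"
    and uniq: "\<And>d. (\<Sum>e\<in>C. d e *\<^sub>R pl_row X (e, None) g) = 0 \<Longrightarrow> \<exists>\<kappa>. \<forall>e\<in>C. d e = \<kappa> * c e"
  shows "dim ((\<lambda>s. pl_row X s g) ` block_rows C) + nu X C \<le> card C"
proof -
  let ?r = "\<lambda>e. pl_row X (e, None) g"
  let ?T = "(\<lambda>s. pl_row X s g) ` block_rows C"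
  define Q :: "(real^2^'v) set" where "Q = (\<Union>k\<in>X \<inter> \<Union>C. axis k ` {axis 1 1})"
  let ?Z = "{z. \<forall>x\<in>?r ` C. x \<bullet> z = 0}"
  let ?K = "{z. \<forall>x\<in>?T \<union> Q. x \<bullet> z = 0}"
  have "?Z \<subseteq> {x + y |x y. x \<in> span {rotation X g} \<and> y \<in> ?K}"
  proof
    fix z assume "z \<in> ?Z"
    then have z: "\<And>e. e \<in> C \<Longrightarrow> ?r e \<bullet> z = 0" by blast
    have "\<forall>e\<in>C. \<exists>\<omega>. (\<forall>k\<in>X \<inter> e. z $ k $ 1 = \<omega>)
      \<and> (\<forall>l d. l \<notin> X \<longrightarrow> pl_row_deriv X g l d (e, None) \<bullet> z = \<omega> * (perp (?r e $ l) \<bullet> d))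
      \<and> (\<forall>b. pl_row X (e, Some b) g \<bullet> (z - \<omega> *\<^sub>R rotation X g) = 0)"
      using edge_angular_velocity[OF edges g z] by blast
    then obtain \<omega> where \<omega>: "\<And>e k. e \<in> C \<Longrightarrow> k \<in> X \<inter> e \<Longrightarrow> z $ k $ 1 = \<omega> e"
      "\<And>e l d. e \<in> C \<Longrightarrow> l \<notin> X \<Longrightarrow> pl_row_deriv X g l d (e, None) \<bullet> z = \<omega> e * (perp (?r e $ l) \<bullet> d)"
      "\<And>e b. e \<in> C \<Longrightarrow> pl_row X (e, Some b) g \<bullet> (z - \<omega> e *\<^sub>R rotation X g) = 0"
      unfolding bchoice_iff by blast
    \<comment> \<open>The products \<open>\<omega> e * c e\<close> again form a dependency, so
      \<open>uniq\<close> makes \<open>\<omega>\<close> constant. At a line \<open>l\<close> all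
      edges through \<open>l\<close> share the angular velocity of \<open>l\<close>; at a point
      \<open>l\<close> the derivative of the dependency in \<open>l\<close> is orthogonal to
      \<open>z\<close>.\<close>
    have "(\<Sum>e\<in>C. (\<omega> e * c e) *\<^sub>R ?r e) $ l = 0" for l
    proof (cases "l \<in> X")
      case True
      have "(\<omega> e * c e) *\<^sub>R ?r e $ l = z $ l $ 1 *\<^sub>R (c e *\<^sub>R ?r e $ l)" if "e \<in> C" for e
        using \<omega>(1)[OF that, of l] True pl_row_nth_eq_0[of l "(e, None)" X g] by (cases "l \<in> e") auto
      then have "(\<Sum>e\<in>C. (\<omega> e * c e) *\<^sub>R ?r e $ l) = (\<Sum>e\<in>C. z $ l $ 1 *\<^sub>R (c e *\<^sub>R ?r e $ l))"
        by (rule sum.cong[OF refl])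
      then have "(\<Sum>e\<in>C. (\<omega> e * c e) *\<^sub>R ?r e) $ l = z $ l $ 1 *\<^sub>R (\<Sum>e\<in>C. c e *\<^sub>R ?r e) $ l"
        by (simp add: scaleR_sum_right)
      then show ?thesis using dep(1) by simp
    next
      case False
      define y where "y = (\<Sum>e\<in>C. (\<omega> e * c e) *\<^sub>R ?r e) $ l"
      have "perp y \<bullet> d = 0" for d
      proof -
        let ?c = "\<lambda>s. c (fst s)"
        have sumC: "(\<Sum>s\<in>C \<times> {None}. f s) = (\<Sum>e\<in>C. f (e, None))" for f :: "_ \<Rightarrow> real^2^'v"
          by (simp add: sum.cartesian_product')
        have "(\<Sum>s\<in>C \<times> {None}. ?c s *\<^sub>R pl_row_deriv X g l d s) \<in> span ((\<lambda>s. pl_row X s g) ` (C \<times> {None}))"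
        proof (rule generic_at_derivative_in_span[OF _ gen I])
          show "pl_row X s (g + t *\<^sub>R axis l d) = pl_row X s g + t *\<^sub>R pl_row_deriv X g l d s"
            if "s \<in> C \<times> {None}" for s t
            using that False by (intro pl_row_line) auto
          show "(\<Sum>s\<in>C \<times> {None}. ?c s *\<^sub>R pl_row X s g) = 0" unfolding sumC using dep by simp
        qed (auto intro: continuous_on_pl_row)
        moreover have "orthogonal z x" if "x \<in> span ((\<lambda>s. pl_row X s g) ` (C \<times> {None}))" for x
          using z by (intro orthogonal_to_span[OF that]) (auto simp: orthogonal_def inner_commute)
        ultimately have "0 = z \<bullet> (\<Sum>e\<in>C. c e *\<^sub>R pl_row_deriv X g l d (e, None))"
          unfolding sumC orthogonal_def by simp
        also have "\<dots> = (\<Sum>e\<in>C. c e * (\<omega> e * (perp (?r e $ l) \<bullet> d)))"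
          using \<omega>(2) False by (simp add: inner_sum_right inner_commute)
        also have "\<dots> = perp y \<bullet> d"
          by (simp add: y_def linear_sum[OF linear_perp] inner_sum_left algebra_simps)
        finally show ?thesis by simp
      qed
      then have "perp y = 0" using inner_eq_zero_iff by blast
      then show ?thesis by (simp add: y_def)
    qed
    then have "(\<Sum>e\<in>C. (\<omega> e * c e) *\<^sub>R ?r e) = 0" by (simp add: vec_eq_iff)
    then obtain \<kappa> where "\<forall>e\<in>C. \<omega> e * c e = \<kappa> * c e"
      using uniq[of "\<lambda>e. \<omega> e * c e"] by blast
    then have \<kappa>: "\<And>e. e \<in> C \<Longrightarrow> \<omega> e = \<kappa>" using dep(2) by simp
    define y where "y = z - \<kappa> *\<^sub>R rotation X g"
    have "y \<in> ?K"
    proof -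
      have "x \<bullet> y = 0" if "x \<in> ?T" for x
        using that \<omega>(3) \<kappa> by (auto simp: y_def block_rows_def)
      moreover have "x \<bullet> y = 0" if x: "x \<in> Q" for x
      proof -
        obtain k e where k: "k \<in> X" "k \<in> e" "e \<in> C" "x = axis k (axis 1 1)"
          using x by (auto simp: Q_def)
        then have "y $ k $ 1 = 0" using \<omega>(1)[of e k] \<kappa> by (simp add: y_def rotation_def axis_def)
        then show ?thesis using k by (simp add: inner_axis')
      qed
      ultimately show ?thesis by blast
    qed
    moreover have "z = \<kappa> *\<^sub>R rotation X g + y" by (simp add: y_def)
    moreover have "\<kappa> *\<^sub>R rotation X g \<in> span {rotation X g}" by (simp add: span_base span_scale)
    ultimately show "z \<in> {x + y |x y. x \<in> span {rotation X g} \<and> y \<in> ?K}" by blast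
  qed
  moreover have "subspace ?K" by (auto simp: subspace_def inner_add_right)
  ultimately have "dim ?Z \<le> dim (span {rotation X g}) + dim ?K"
    by (intro dim_le_sum_dim) auto
  moreover have "dim {rotation X g} \<le> card {rotation X g}" by (intro dim_le_card) (auto intro: span_base)
  moreover have "dim ?Z + dim (?r ` C) = DIM(real^2^'v)" "dim ?K + dim (?T \<union> Q) = DIM(real^2^'v)"
    by (rule dim_orthogonal_complement)+
  moreover have "dim (?T \<union> Q) = dim ?T + nu X C"
  proof -
    have "x \<bullet> y = 0" if xy: "x \<in> ?T" "y \<in> Q" for x y
    proof -
      obtain e b where e: "e \<in> C" "x = pl_row X (e, Some b) g" using xy(1) by (auto simp: block_rows_def)
      obtain k where k: "k \<in> X" "y = axis k (axis 1 1)" using xy(2) by (auto simp: Q_def)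
      show ?thesis using k e pl_row_line_component by (simp add: inner_axis)
    qed
    then have "dim (?T \<union> Q) = dim ?T + dim Q" by (rule dim_orthogonal_sum)
    moreover have "dim Q = nu X C"
      unfolding Q_def by (subst dim_UN_axes) (auto simp: Basis_vec_def nu_eq)
    ultimately show ?thesis by simp
  qed
  moreover have "dim (?r ` C) < card C"
  proof -
    obtain e0 where e0: "e0 \<in> C" using ne by blast
    have "c e0 *\<^sub>R ?r e0 = - (\<Sum>e\<in>C - {e0}. c e *\<^sub>R ?r e)"
      using dep(1) e0 by (simp add: sum.remove add_eq_0_iff)
    moreover have "?r e0 = (1 / c e0) *\<^sub>R (c e0 *\<^sub>R ?r e0)" using dep(2)[OF e0] by simp
    ultimately have "?r e0 = (1 / c e0) *\<^sub>R (- (\<Sum>e\<in>C - {e0}. c e *\<^sub>R ?r e))" by simp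
    also have "\<dots> \<in> span (?r ` (C - {e0}))"
      by (intro span_scale span_neg span_sum) (auto intro: span_base)
    finally have "?r ` C \<subseteq> span (?r ` (C - {e0}))" by (auto intro: span_base)
    then have "dim (?r ` C) \<le> card (?r ` (C - {e0}))" by (intro dim_le_card) auto
    also have "\<dots> \<le> card (C - {e0})" by (rule card_image_le) simp
    also have "\<dots> < card C" using e0 by (intro psubset_card_mono) auto
    finally show ?thesis .
  qed
  ultimately show ?thesis by simp
qed

text \<open>Every solution on the vertices of \<open>B\<close> is a translation
  \<open>\<tau>\<close>, which changes the offset of a line with normal \<open>g $ k\<close> at the
  rate \<open>- (\<tau> \<bullet> g $ k)\<close>. The first coordinate of a line is left free, as
  all these rows vanish there.\<close>

definition tight :: "'v::finite set \<Rightarrow> real^2^'v \<Rightarrow> 'v set set \<Rightarrow> bool" where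
  "tight X g B \<longleftrightarrow> (\<forall>z. (\<forall>s\<in>block_rows B. pl_row X s g \<bullet> z = 0) \<longrightarrow>
     (\<exists>\<tau>. \<forall>k\<in>\<Union>B. (k \<notin> X \<longrightarrow> z $ k = \<tau>) \<and> (k \<in> X \<longrightarrow> z $ k $ 2 = - (\<tau> \<bullet> g $ k))))"

lemma finite_block_rows [simp]: "finite (block_rows B)"
  by (simp add: block_rows_def)

text \<open>Two points move equally by their two rows, and the row of a point-line edge determines
  the offset velocity from the point. A line-line edge has only zero rows, but any offset velocities
  of two nonparallel lines come from a translation.\<close>

lemma tight_singleton:
  assumes e: "card e = 2" and g: "nonparallel g"
  shows "tight X g {e}"
  unfolding tight_def
proof (intro allI impI)
  fix z assume z: "\<forall>s\<in>block_rows {e}. pl_row X s g \<bullet> z = 0"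
  obtain i j where ij: "e = {i, j}" "i \<noteq> j" "i \<in> X \<longrightarrow> j \<in> X"
    using e unfolding card_2_iff by (metis insert_commute)
  have z': "entry (Some b) X g i j \<bullet> z $ i + entry (Some b) X g j i \<bullet> z $ j = 0" for b
    using z ij(1) by (simp add: block_rows_def inner_pl_row[OF ij(2), symmetric])
  consider "i \<notin> X" "j \<notin> X" | "i \<notin> X" "j \<in> X" | "i \<in> X" "j \<in> X" using ij(3) by blast
  then show "\<exists>\<tau>. \<forall>k\<in>\<Union>{e}. (k \<notin> X \<longrightarrow> z $ k = \<tau>) \<and> (k \<in> X \<longrightarrow> z $ k $ 2 = - (\<tau> \<bullet> g $ k))"
  proof cases
    case 1
    have nz: "g $ i - g $ j \<noteq> 0" using nonparallel_neq[OF g ij(2)] by simp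
    moreover have "(g $ i - g $ j) \<bullet> (z $ i - z $ j) = 0"
      using z'[of False] 1 by (simp add: entry_def inner_diff_left inner_diff_right)
    ultimately obtain c where c: "z $ i - z $ j = c *\<^sub>R perp (g $ i - g $ j)"
      using inner_eq_0_imp_perp_multiple by metis
    have "perp (g $ i - g $ j) \<bullet> (z $ i - z $ j) = 0"
      using z'[of True] 1 by (simp add: entry_def inner_diff_left inner_diff_right)
    then have "c * (perp (g $ i - g $ j) \<bullet> perp (g $ i - g $ j)) = 0"
      by (simp only: c inner_scaleR_right)
    then have "c = 0"
      using nz by (simp only: mult_eq_0_iff inner_eq_zero_iff perp_eq_0_iff) blast
    then have "z $ i = z $ j" using c by simp
    then show ?thesis using 1 ij(1) by (intro exI[of _ "z $ i"]) auto
  next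
    case 2
    then have "z $ j $ 2 = - (z $ i \<bullet> g $ j)"
      using z'[of False] by (simp add: entry_def inner_axis inner_axis' inner_commute eq_neg_iff_add_eq_0 add.commute)
    then show ?thesis using 2 ij(1) by (intro exI[of _ "z $ i"]) auto
  next
    case 3
    let ?D = "g $ i \<bullet> perp (g $ j)"
    have D: "?D \<noteq> 0" using g ij(2) by (simp add: nonparallel_def)
    \<comment> \<open>Cramer's rule for the two equations
      \<open>\<tau> \<bullet> g $ i = - (z $ i $ 2)\<close> and
      \<open>\<tau> \<bullet> g $ j = - (z $ j $ 2)\<close>.\<close>
    define \<tau> where "\<tau> = (1 / ?D) *\<^sub>R (z $ j $ 2 *\<^sub>R perp (g $ i) - z $ i $ 2 *\<^sub>R perp (g $ j))"
    have "\<tau> \<bullet> g $ i = - (z $ i $ 2)" "\<tau> \<bullet> g $ j = - (z $ j $ 2)"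
      using D inner_commute[of "perp (g $ j)" "g $ i"] inner_perp_swap[of "g $ i" "g $ j"]
      by (simp_all add: \<tau>_def inner_diff_left)
    then show ?thesis using 3 ij(1) by (intro exI[of _ \<tau>]) auto
  qed
qed

text \<open>The relevant coordinates are two per point and one per line; up to at most two
  dimensions of translations, the rows must fix all of them.\<close>

lemma tight_imp_dim_ge:
  fixes X :: "'v::finite set"
  assumes "tight X g B"
  shows "2 * nu (UNIV - X) B + nu X B \<le> dim ((\<lambda>s. pl_row X s g) ` block_rows B) + 2"
proof -
  let ?T = "(\<lambda>s. pl_row X s g) ` block_rows B"
  define D :: "'v \<Rightarrow> (real^2) set" where "D k = (if k \<in> X then {axis 2 1} else {axis 1 1, axis 2 1})" for k
  define Q :: "(real^2^'v) set" where "Q = (\<Union>k\<in>\<Union>B. axis k ` D k)"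
  define tr where "tr \<tau> = (\<chi> k. if k \<in> X then - (\<tau> \<bullet> g $ k) *\<^sub>R axis 2 1 else \<tau>)" for \<tau>
  have tr: "linear tr"
    by (rule linearI) (auto simp: tr_def vec_eq_iff inner_add_left algebra_simps)
  let ?Z = "{z. \<forall>x\<in>?T. x \<bullet> z = 0}" and ?Y = "{z. \<forall>x\<in>Q. x \<bullet> z = 0}"
  have "?Z \<subseteq> {x + y |x y. x \<in> range tr \<and> y \<in> ?Y}"
  proof
    fix z assume "z \<in> ?Z"
    then obtain \<tau> where \<tau>: "\<forall>k\<in>\<Union>B. (k \<notin> X \<longrightarrow> z $ k = \<tau>) \<and> (k \<in> X \<longrightarrow> z $ k $ 2 = - (\<tau> \<bullet> g $ k))"
      using assms unfolding tight_def by blast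
    have "x \<bullet> (z - tr \<tau>) = 0" if x: "x \<in> Q" for x
    proof -
      obtain k d where k: "k \<in> \<Union>B" "d \<in> D k" "x = axis k d"
        using x unfolding Q_def by blast
      then show ?thesis using bspec[OF \<tau> k(1)]
        by (cases "k \<in> X") (auto simp: D_def inner_axis' tr_def)
    qed
    moreover have "z = tr \<tau> + (z - tr \<tau>)" by simp
    ultimately show "z \<in> {x + y |x y. x \<in> range tr \<and> y \<in> ?Y}" by blast
  qed
  moreover have "subspace (range tr)" using linear_subspace_image[OF tr] by simp
  moreover have "subspace ?Y" by (auto simp: subspace_def inner_add_right)
  ultimately have "dim ?Z \<le> dim (range tr) + dim ?Y" by (intro dim_le_sum_dim) auto
  moreover have "dim (range tr) \<le> 2" using dim_image_le[OF tr, of UNIV] by simp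
  moreover have "dim ?Z + dim ?T = DIM(real^2^'v)" "dim ?Y + dim Q = DIM(real^2^'v)"
    by (rule dim_orthogonal_complement)+
  moreover have "dim Q = 2 * nu (UNIV - X) B + nu X B"
  proof -
    have "dim Q = (\<Sum>k\<in>\<Union>B. card (D k))"
      unfolding Q_def by (rule dim_UN_axes) (auto simp: D_def Basis_vec_def)
    also have "\<dots> = (\<Sum>k\<in>\<Union>B. if k \<in> X then 1 else 2)"
      by (intro sum.cong) (auto simp: D_def axis_eq_axis)
    also have "\<dots> = card (X \<inter> \<Union>B) + 2 * card ((UNIV - X) \<inter> \<Union>B)"
      by (simp add: sum.If_cases Int_commute Compl_eq_Diff_UNIV)
    finally show ?thesis by (simp add: nu_eq)
  qed
  ultimately show ?thesis by linarith
qed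

text \<open>The normal of \<open>l\<close> occurs only as the entry at a point joined to
  \<open>l\<close>, and that point has velocity \<open>\<tau>\<close>; in such a row the second
  coordinate at \<open>l\<close> is 1. For all other edges both sides vanish. Derivatives in a line
  thus recover the component of a dependency at that line.\<close>

lemma inner_pl_row_deriv_translation:
  assumes e: "card e = 2" and l: "l \<in> X" and z: "\<And>k. k \<in> e \<Longrightarrow> k \<notin> X \<Longrightarrow> z $ k = \<tau>"
  shows "pl_row_deriv X g l d (e, Some b) \<bullet> z = (d \<bullet> \<tau>) * pl_row X (e, Some b) g $ l $ 2"
proof -
  obtain i j where ij: "e = {i, j}" "i \<noteq> j" "i \<in> X \<longrightarrow> j \<in> X"
    using e unfolding card_2_iff by (metis insert_commute)
  then have "i \<notin> X \<Longrightarrow> z $ i = \<tau>" using z by blast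
  then show ?thesis using l ij(2,3) unfolding ij(1)
    by (auto simp: inner_pl_row_deriv pl_row_nth entry_def entry_deriv_def axis_def)
qed

text \<open>Take a partition into tight blocks with as few blocks as possible. If the row spaces of its
  blocks were not independent, a shortest dependency between them would, by differentiating it
  in the line parameters, force the union of the blocks involved to be tight.\<close>

lemma tight_partition_exists:
  fixes X :: "'v::finite set"
  assumes edges: "\<And>e. e \<in> C \<Longrightarrow> card e = 2" and g: "nonparallel g"
    and gen: "generic_at (pl_row X) I g" and I: "block_rows C \<subseteq> I"
  shows "\<exists>P. partition_on C P \<and>
    (\<Sum>B\<in>P. 2 * int (nu (UNIV - X) B) + int (nu X B) - 2) \<le> int (dim ((\<lambda>s. pl_row X s g) ` block_rows C))"
proof -
  let ?T = "\<lambda>B. (\<lambda>s. pl_row X s g) ` block_rows B"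
  define good where "good P \<longleftrightarrow> partition_on C P \<and> (\<forall>B\<in>P. tight X g B)" for P
  have "good ((\<lambda>e. {e}) ` C)"
    using edges tight_singleton[OF _ g] partition_on_singletons by (auto simp: good_def)
  then obtain P where P: "good P" and least: "\<And>P'. good P' \<Longrightarrow> card P \<le> card P'"
    using ex_has_least_nat[of good _ card] by blast
  have part: "partition_on C P" and tP: "\<And>B. B \<in> P \<Longrightarrow> tight X g B"
    using P by (auto simp: good_def)
  have CP: "C = \<Union>P" and disj: "\<And>B B'. B \<in> P \<Longrightarrow> B' \<in> P \<Longrightarrow> B \<noteq> B' \<Longrightarrow> B \<inter> B' = {}"
    using part by (auto simp: partition_on_def disjoint_def)
  define dep where "dep w \<longleftrightarrow> (\<forall>B\<in>P. w B \<in> span (?T B)) \<and> (\<Sum>B\<in>P. w B) = 0 \<and> (\<exists>B\<in>P. w B \<noteq> 0)" for w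
  define supp where "supp w = {B \<in> P. w B \<noteq> 0}" for w :: "'v set set \<Rightarrow> real^2^'v"
  have no_dep: False if dep0: "dep w0" for w0
  proof -
    obtain w where w: "dep w" and wmin: "\<And>w'. dep w' \<Longrightarrow> card (supp w) \<le> card (supp w')"
      using ex_has_least_nat[of dep w0 "\<lambda>w. card (supp w)"] dep0 by blast
    have wT: "\<And>B. B \<in> P \<Longrightarrow> w B \<in> span (?T B)" and w0: "(\<Sum>B\<in>P. w B) = 0"
      using w by (auto simp: dep_def)
    define J where "J = supp w"
    have JP: "J \<subseteq> P" by (auto simp: J_def supp_def)
    obtain B0 where B0: "B0 \<in> J" using w by (auto simp: dep_def J_def supp_def)
    have sumJ: "(\<Sum>B\<in>J. f B) = (\<Sum>B\<in>P. f B)" if "\<And>B. B \<in> P \<Longrightarrow> w B = 0 \<Longrightarrow> f B = 0"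
      for f :: "_ \<Rightarrow> real^2^'v"
      using that JP by (intro sum.mono_neutral_left) (auto simp: J_def supp_def)
    define U where "U = \<Union>J"
    have UC: "U \<subseteq> C" using JP CP by (auto simp: U_def)
    have "\<exists>c. w B = (\<Sum>s\<in>block_rows B. c s *\<^sub>R pl_row X s g)" if "B \<in> P" for B
      by (rule span_image_coefficients) (use wT[OF that] in auto)
    then obtain c where c: "\<And>B. B \<in> P \<Longrightarrow> w B = (\<Sum>s\<in>block_rows B. c B s *\<^sub>R pl_row X s g)"
      by metis
    define blk where "blk e = (THE B. B \<in> P \<and> e \<in> B)" for e
    have blk: "blk e = B" if "B \<in> P" "e \<in> B" for e B
      unfolding blk_def using that disj by (intro the_equality) blast+
    \<comment> \<open>The blocks are disjoint, so their coefficients glue to one dependency between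
      the rows of \<open>U\<close>, to which genericity applies.\<close>
    define c' where "c' s = c (blk (fst s)) s" for s
    have c': "w B = (\<Sum>s\<in>block_rows B. c' s *\<^sub>R pl_row X s g)" if B: "B \<in> P" for B
      unfolding c[OF B] by (intro sum.cong refl) (auto simp: c'_def block_rows_def blk[OF B])
    have block_rows_U: "(\<Sum>s\<in>block_rows U. f s) = (\<Sum>B\<in>J. \<Sum>s\<in>block_rows B. f s)" for f :: "_ \<Rightarrow> real^2^'v"
    proof -
      have "block_rows U = (\<Union>B\<in>J. block_rows B)" by (auto simp: U_def block_rows_def)
      moreover have "\<forall>B\<in>J. \<forall>B'\<in>J. B \<noteq> B' \<longrightarrow> block_rows B \<inter> block_rows B' = {}"
        using JP disj by (fastforce simp: block_rows_def)
      ultimately show ?thesis by (simp add: sum.UNION_disjoint)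
    qed
    have "tight X g U"
      unfolding tight_def
    proof (intro allI impI)
      fix z assume z: "\<forall>s\<in>block_rows U. pl_row X s g \<bullet> z = 0"
      have "\<exists>\<tau>. \<forall>k\<in>\<Union>B. (k \<notin> X \<longrightarrow> z $ k = \<tau>) \<and> (k \<in> X \<longrightarrow> z $ k $ 2 = - (\<tau> \<bullet> g $ k))"
        if B: "B \<in> J" for B
      proof -
        have "tight X g B" using tP JP B by blast
        moreover have "\<forall>s\<in>block_rows B. pl_row X s g \<bullet> z = 0" using z B by (auto simp: U_def block_rows_def)
        ultimately show ?thesis unfolding tight_def by blast
      qed
      then obtain \<tau> where \<tau>: "\<And>B k. B \<in> J \<Longrightarrow> k \<in> \<Union>B \<Longrightarrow>
          (k \<notin> X \<longrightarrow> z $ k = \<tau> B) \<and> (k \<in> X \<longrightarrow> z $ k $ 2 = - (\<tau> B \<bullet> g $ k))"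
        by metis
      have supp_row: "w B $ k = 0" if "B \<in> P" "k \<notin> \<Union>B" for B k
        using that by (auto simp: c' block_rows_def pl_row_nth_eq_0 intro!: sum.neutral)
      have line1: "w B $ k $ 1 = 0" if B: "B \<in> P" and k: "k \<in> X" for B k
      proof -
        have "pl_row X s g $ k $ 1 = 0" if s: "s \<in> block_rows B" for s
          using k s by (auto simp: block_rows_def pl_row_line_component)
        then show ?thesis by (simp add: c'[OF B])
      qed
      \<comment> \<open>The weights \<open>d \<bullet> \<tau> B\<close> preserve the dependency. At
        a point \<open>k\<close> every block through \<open>k\<close> has
        \<open>\<tau> B = z $ k\<close>; at a line \<open>k\<close> the derivative of the dependency
        in the normal of \<open>k\<close> is orthogonal to \<open>z\<close>.\<close>
      have comb: "(\<Sum>B\<in>J. (d \<bullet> \<tau> B) *\<^sub>R w B) = 0" for d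
      proof -
        have "(\<Sum>B\<in>J. (d \<bullet> \<tau> B) *\<^sub>R w B) $ k = 0" for k
        proof (cases "k \<in> X")
          case False
          have "(d \<bullet> \<tau> B) *\<^sub>R w B $ k = (d \<bullet> z $ k) *\<^sub>R w B $ k" if "B \<in> J" for B
            using \<tau>[OF that, of k] supp_row[of B k] False that JP by (cases "k \<in> \<Union>B") auto
          then have "(\<Sum>B\<in>J. (d \<bullet> \<tau> B) *\<^sub>R w B $ k) = (\<Sum>B\<in>J. (d \<bullet> z $ k) *\<^sub>R w B $ k)"
            by (rule sum.cong[OF refl])
          also have "\<dots> = (d \<bullet> z $ k) *\<^sub>R (\<Sum>B\<in>J. w B) $ k" by (simp add: scaleR_sum_right)
          also have "(\<Sum>B\<in>J. w B) = 0" using w0 by (subst sumJ) auto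
          finally show ?thesis by simp
        next
          case True
          have "(\<Sum>s\<in>block_rows U. c' s *\<^sub>R pl_row_deriv X g k d s) \<in> span ((\<lambda>s. pl_row X s g) ` block_rows U)"
          proof (rule generic_at_derivative_in_span[OF _ gen])
            show "block_rows U \<subseteq> I" using UC I by (auto simp: block_rows_def)
            show "pl_row X s (g + t *\<^sub>R axis k d) = pl_row X s g + t *\<^sub>R pl_row_deriv X g k d s"
              if "s \<in> block_rows U" for s t
              using that True by (intro pl_row_line) (auto simp: block_rows_def)
            have "(\<Sum>s\<in>block_rows U. c' s *\<^sub>R pl_row X s g) = (\<Sum>B\<in>J. w B)"
              unfolding block_rows_U using JP c' by (intro sum.cong) auto
            also have "\<dots> = 0" using w0 by (subst sumJ) auto
            finally show "(\<Sum>s\<in>block_rows U. c' s *\<^sub>R pl_row X s g) = 0" .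
          qed (auto intro: continuous_on_pl_row)
          moreover have "orthogonal z x" if "x \<in> span ((\<lambda>s. pl_row X s g) ` block_rows U)" for x
            using z by (intro orthogonal_to_span[OF that]) (auto simp: orthogonal_def inner_commute)
          ultimately have "0 = z \<bullet> (\<Sum>s\<in>block_rows U. c' s *\<^sub>R pl_row_deriv X g k d s)"
            unfolding orthogonal_def by simp
          also have "\<dots> = (\<Sum>B\<in>J. \<Sum>s\<in>block_rows B. c' s * (pl_row_deriv X g k d s \<bullet> z))"
            by (simp add: block_rows_U inner_sum_right inner_commute)
          also have "\<dots> = (\<Sum>B\<in>J. \<Sum>s\<in>block_rows B. c' s * ((d \<bullet> \<tau> B) * pl_row X s g $ k $ 2))"
          proof (intro sum.cong refl)
            fix B s assume B: "B \<in> J" and s: "s \<in> block_rows B"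
            obtain e b where e: "s = (e, Some b)" "e \<in> B" using s by (auto simp: block_rows_def)
            have "e \<in> C" using e(2) B JP CP by blast
            then have "pl_row_deriv X g k d s \<bullet> z = (d \<bullet> \<tau> B) * pl_row X s g $ k $ 2"
              unfolding e(1) using \<tau>[OF B] e(2) True edges
              by (intro inner_pl_row_deriv_translation) auto
            then show "c' s * (pl_row_deriv X g k d s \<bullet> z) = c' s * ((d \<bullet> \<tau> B) * pl_row X s g $ k $ 2)"
              by simp
          qed
          also have "\<dots> = (\<Sum>B\<in>J. (d \<bullet> \<tau> B) * w B $ k $ 2)"
            using JP by (intro sum.cong refl) (auto simp: c' sum_distrib_left algebra_simps)
          finally have "(\<Sum>B\<in>J. (d \<bullet> \<tau> B) *\<^sub>R w B) $ k $ 2 = 0" by simp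
          moreover have "(\<Sum>B\<in>J. (d \<bullet> \<tau> B) *\<^sub>R w B) $ k $ 1 = 0"
            using line1 True JP by (auto intro!: sum.neutral)
          ultimately show ?thesis by (simp add: vec_eq_iff forall_2)
        qed
        then show ?thesis by (simp add: vec_eq_iff)
      qed
      have "\<tau> B = \<tau> B0" if B: "B \<in> J" for B
      proof -
        have "d \<bullet> \<tau> B = d \<bullet> \<tau> B0" for d
        proof (rule ccontr)
          assume neq: "d \<bullet> \<tau> B \<noteq> d \<bullet> \<tau> B0"
          \<comment> \<open>Subtracting \<open>d \<bullet> \<tau> B0\<close> from the weights
            removes \<open>B0\<close> from the support, contrary to its minimality.\<close>
          define w' where "w' B = (if B \<in> J then (d \<bullet> \<tau> B - d \<bullet> \<tau> B0) *\<^sub>R w B else 0)" for B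
          have "(\<Sum>B\<in>P. w' B) = (\<Sum>B\<in>J. w' B)"
            by (rule sumJ[symmetric]) (simp add: w'_def)
          also have "\<dots> = (\<Sum>B\<in>J. (d \<bullet> \<tau> B) *\<^sub>R w B) - (d \<bullet> \<tau> B0) *\<^sub>R (\<Sum>B\<in>J. w B)"
            by (simp add: w'_def scaleR_diff_left sum_subtractf scaleR_sum_right)
          also have "\<dots> = 0" using comb w0 sumJ[of w] by simp
          finally have "(\<Sum>B\<in>P. w' B) = 0" .
          moreover have "w' B \<noteq> 0" "B \<in> P"
            using B JP neq by (auto simp: w'_def J_def supp_def)
          moreover have "\<forall>B\<in>P. w' B \<in> span (?T B)"
            using wT by (auto simp: w'_def span_scale span_zero)
          ultimately have "dep w'" unfolding dep_def by blast
          then have "card (supp w) \<le> card (supp w')" by (rule wmin)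
          moreover have "supp w' \<subset> supp w"
            using B0 by (auto simp: w'_def supp_def J_def)
          then have "card (supp w') < card (supp w)" by (intro psubset_card_mono) auto
          ultimately show False by simp
        qed
        then show ?thesis by (metis inner_commute vector_eq_rdot)
      qed
      then show "\<exists>\<tau>. \<forall>k\<in>\<Union>U. (k \<notin> X \<longrightarrow> z $ k = \<tau>) \<and> (k \<in> X \<longrightarrow> z $ k $ 2 = - (\<tau> \<bullet> g $ k))"
        using \<tau> by (intro exI[of _ "\<tau> B0"]) (fastforce simp: U_def)
    qed
    have "good (insert U (P - J))"
    proof -
      have "B0 \<noteq> {}" using B0 JP part by (auto simp: partition_on_def)
      then have "U \<noteq> {}" using B0 by (auto simp: U_def)
      have "partition_on C (insert U (P - J))"
      proof (rule partition_onI)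
        show "\<Union>(insert U (P - J)) = C" using JP unfolding CP U_def by blast
        have UJ: "U \<inter> B = {}" if "B \<in> P - J" for B
          using that JP disj unfolding U_def by blast
        show "disjnt B B'" if "B \<in> insert U (P - J)" "B' \<in> insert U (P - J)" "B \<noteq> B'" for B B'
          using that UJ disj unfolding disjnt_def by blast
        show "{} \<notin> insert U (P - J)"
          using \<open>U \<noteq> {}\<close> part by (auto simp: partition_on_def)
      qed
      then show ?thesis using \<open>tight X g U\<close> tP by (auto simp: good_def)
    qed
    then have "card P \<le> card (insert U (P - J))" by (rule least)
    also have "\<dots> \<le> Suc (card (P - J))" by (simp add: card_insert_if)
    also have "card (P - J) = card P - card J" using JP by (simp add: card_Diff_subset)
    \<comment> \<open>Merging the blocks of \<open>J\<close> cannot reduce their number, so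
      \<open>J\<close> is a single block; but a dependency with one term is zero.\<close>
    finally have "card J \<le> 1"
      using card_mono[OF _ JP] by simp
    then have "J = {B0}"
      using B0 card_le_Suc0_iff_eq[of J] by auto
    then have "w B0 = 0" using sumJ[of w] w0 by simp
    then show False using B0 by (simp add: J_def supp_def)
  qed
  have "(\<Sum>B\<in>P. dim (?T B)) \<le> dim (\<Union>B\<in>P. ?T B)"
  proof (rule sum_dim_le_dim_UN_if_direct)
    fix w assume "\<And>B. B \<in> P \<Longrightarrow> w B \<in> span (?T B)" "(\<Sum>B\<in>P. w B) = 0"
    then show "\<forall>B\<in>P. w B = 0" using no_dep[of w] unfolding dep_def by blast
  qed simp
  also have "(\<Union>B\<in>P. ?T B) = ?T C" unfolding CP by (auto simp: block_rows_def)
  finally have "int (\<Sum>B\<in>P. dim (?T B)) \<le> int (dim (?T C))" by (simp only: of_nat_le_iff)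
  moreover have "(\<Sum>B\<in>P. 2 * int (nu (UNIV - X) B) + int (nu X B) - 2) \<le> int (\<Sum>B\<in>P. dim (?T B))"
    unfolding of_nat_sum
  proof (rule sum_mono)
    fix B assume "B \<in> P"
    then show "2 * int (nu (UNIV - X) B) + int (nu X B) - 2 \<le> int (dim (?T B))"
      using tight_imp_dim_ge[OF tP, of B] by linarith
  qed
  ultimately show ?thesis using part order_trans by blast
qed

section \<open>From the count to a rigid point-line framework\<close>

lemma nonparallel_open_nonempty:
  shows "open {g :: real^2^'v::finite. nonparallel g}" "{g :: real^2^'v. nonparallel g} \<noteq> {}"
proof -
  have "{g :: real^2^'v. nonparallel g} = (\<Inter>i. \<Inter>j\<in>- {i}. {g. g $ i \<bullet> perp (g $ j) \<noteq> 0})"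
    by (auto simp: nonparallel_def)
  moreover have "open {g :: real^2^'v. g $ i \<bullet> perp (g $ j) \<noteq> 0}" for i j
    by (intro open_Collect_neq continuous_intros)
  ultimately show "open {g :: real^2^'v. nonparallel g}" by (auto intro!: open_INT)
  obtain f :: "'v \<Rightarrow> nat" where f: "inj f" using finite_imp_inj_to_nat_seg[OF finite] by auto
  define g :: "real^2^'v" where "g = (\<chi> i. vector [1, real (f i)])"
  have "nonparallel g"
    using f by (auto simp: nonparallel_def g_def inner_real2 inj_def)
  then show "{g :: real^2^'v. nonparallel g} \<noteq> {}" by blast
qed

text \<open>On a circuit the two rank estimates combine to a lower bound for \<open>card C\<close>
  that is one more than the upper bound assumed in \<open>count\<close>.\<close>

lemma count_imp_independent_rows:
  fixes X :: "'v::finite set"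
  assumes edges: "\<And>e. e \<in> E' \<Longrightarrow> card e = 2"
    and count: "\<And>A P. A \<subseteq> E' \<Longrightarrow> A \<noteq> {} \<Longrightarrow> partition_on A P \<Longrightarrow> int (card A) \<le>
       (\<Sum>B\<in>P. 2 * int (nu (UNIV - X) B) + int (nu X B) - 2) + int (nu X A) - 1"
  shows "\<exists>g. nonparallel g \<and> indep_family (\<lambda>e. pl_row X (e, None) g) E'"
proof -
  \<comment> \<open>One \<open>g\<close> must be generic for all three rows of each edge, because
    the argument differentiates dependencies of both systems.\<close>
  obtain g where g: "nonparallel g" and gen: "generic_at (pl_row X) (E' \<times> UNIV) g"
    using generic_at_exists[of "E' \<times> UNIV" "pl_row X", OF _ _ nonparallel_open_nonempty]
    by (auto intro: continuous_on_pl_row)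
  let ?r = "\<lambda>e. pl_row X (e, None) g"
  have "indep_family ?r E'"
  proof (rule ccontr)
    assume "\<not> indep_family ?r E'"
    then obtain C where C: "C \<subseteq> E'" "\<not> indep_family ?r C"
      and least: "\<And>A. A \<subseteq> E' \<Longrightarrow> \<not> indep_family ?r A \<Longrightarrow> card C \<le> card A"
      using ex_has_least_nat[of "\<lambda>A. A \<subseteq> E' \<and> \<not> indep_family ?r A" E' card] by blast
    \<comment> \<open>In a smallest dependent set a dependency that vanishes at one edge vanishes
      everywhere; hence all dependencies are proportional.\<close>
    have minimal: "d e = 0" if d: "(\<Sum>e\<in>C. d e *\<^sub>R ?r e) = 0" "e0 \<in> C" "d e0 = 0" "e \<in> C" for d e0 e
    proof (rule ccontr)
      assume "d e \<noteq> 0"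
      have "(\<Sum>e\<in>C - {e0}. d e *\<^sub>R ?r e) = 0" using d by (simp add: sum.remove[of C e0])
      moreover have "e \<in> C - {e0}" using \<open>d e \<noteq> 0\<close> d by auto
      ultimately have "\<not> indep_family ?r (C - {e0})"
        using \<open>d e \<noteq> 0\<close> unfolding indep_family_def by blast
      then have "card C \<le> card (C - {e0})" using C(1) by (intro least) auto
      moreover have "card (C - {e0}) < card C" using d(2) by (intro psubset_card_mono) auto
      ultimately show False by simp
    qed
    obtain c e1 where c: "(\<Sum>e\<in>C. c e *\<^sub>R ?r e) = 0" "e1 \<in> C" "c e1 \<noteq> 0"
      using C(2) unfolding indep_family_def by blast
    have c0: "c e \<noteq> 0" if "e \<in> C" for e using minimal[OF c(1) that _ c(2)] c(3) by blast
    have uniq: "\<exists>\<kappa>. \<forall>e\<in>C. d e = \<kappa> * c e" if d: "(\<Sum>e\<in>C. d e *\<^sub>R ?r e) = 0" for d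
    proof -
      define \<kappa> where "\<kappa> = d e1 / c e1"
      have "(\<Sum>e\<in>C. (d e - \<kappa> * c e) *\<^sub>R ?r e) = (\<Sum>e\<in>C. d e *\<^sub>R ?r e) - \<kappa> *\<^sub>R (\<Sum>e\<in>C. c e *\<^sub>R ?r e)"
        by (simp add: scaleR_diff_left sum_subtractf scaleR_sum_right)
      then have "(\<Sum>e\<in>C. (d e - \<kappa> * c e) *\<^sub>R ?r e) = 0" using d c(1) by simp
      moreover have "d e1 - \<kappa> * c e1 = 0" using c(3) by (simp add: \<kappa>_def)
      ultimately have "d e - \<kappa> * c e = 0" if "e \<in> C" for e
        using minimal[of "\<lambda>e. d e - \<kappa> * c e" e1 e] c(2) that by blast
      then show ?thesis by (intro exI[of _ \<kappa>]) simp
    qed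
    have edgesC: "card e = 2" if "e \<in> C" for e using edges C(1) that by blast
    have "dim ((\<lambda>s. pl_row X s g) ` block_rows C) + nu X C \<le> card C"
      by (rule circuit_rank_bound[OF edgesC g gen _ c(1) c0 _ uniq]) (use C(1) c(2) in auto)
    moreover obtain P where P: "partition_on C P"
      "(\<Sum>B\<in>P. 2 * int (nu (UNIV - X) B) + int (nu X B) - 2) \<le> int (dim ((\<lambda>s. pl_row X s g) ` block_rows C))"
      using tight_partition_exists[OF edgesC g gen] C(1) by (auto simp: block_rows_def)
    moreover have "int (card C) \<le>
       (\<Sum>B\<in>P. 2 * int (nu (UNIV - X) B) + int (nu X B) - 2) + int (nu X C) - 1"
      using count[OF C(1) _ P(1)] c(2) by blast
    ultimately show False by linarith
  qed
  then show ?thesis using g by blast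
qed

text \<open>After normalising the normals, the motions embed into the kernel of
  \<open>2 * CARD('v) - 3\<close> independent rows, which has dimension 3. The trivial motions give
  the opposite inequality.\<close>

lemma independent_rows_imp_point_line:
  fixes E :: "'v::finite set set"
  assumes sg: "simple_graph E" and E': "E' \<subseteq> E" "int (card E') = 2 * int (card (UNIV :: 'v set)) - 3"
    and g: "nonparallel g" and ind: "indep_family (\<lambda>e. pl_row X (e, None) g) E'"
  shows "\<exists>p l. point_line_framework X E p l \<and> point_line_inf_rigid X E p l"
proof -
  define a where "a k = sgn (g $ k)" for k
  define n where "n k = norm (g $ k)" for k
  \<comment> \<open>With a single vertex \<open>2 * CARD('v) - 3\<close> would be negative.\<close>
  have other: "\<exists>j. j \<noteq> k" for k :: 'v
  proof (rule ccontr)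
    assume "\<not> ?thesis"
    then have "(UNIV :: 'v set) = {k}" by blast
    then have "card (UNIV :: 'v set) = card {k}" by (simp only:)
    then show False using E'(2) by simp
  qed
  have g0: "g $ k \<noteq> 0" for k
    using other[of k] g unfolding nonparallel_def by (metis inner_zero_left)
  have ga: "g $ k = n k *\<^sub>R a k" for k using g0[of k] by (simp add: a_def n_def sgn_div_norm)
  have n0: "n k \<noteq> 0" for k using g0 by (simp add: n_def)
  have aa: "a k \<bullet> a k = 1" for k using g0[of k] by (simp add: a_def dot_square_norm norm_sgn)
  have anp: "a i \<bullet> perp (a j) \<noteq> 0" if "i \<noteq> j" for i j
  proof -
    have "n i * n j * (a i \<bullet> perp (a j)) \<noteq> 0"
      using g that by (simp add: nonparallel_def ga)
    then show ?thesis by simp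
  qed
  define l where "l k = (a k, 0 :: real)" for k
  let ?p = "\<lambda>k. g $ k"
  let ?M = "point_line_motions X E ?p l"
  have fw: "point_line_framework X E ?p l"
    using sg aa by (simp add: point_line_framework_def l_def norm_eq_sqrt_inner)
  have "dim ?M \<le> 3"
  proof -
    \<comment> \<open>Rescaling a normal by \<open>n k\<close> leaves the angular velocity of the
      line unchanged and multiplies the velocity of its offset by \<open>n k\<close>.\<close>
    define F :: "(real^2^'v) \<times> (real^2^'v) \<times> (real^'v) \<Rightarrow> real^2^'v" where
      "F = (\<lambda>(p', a', r'). \<chi> k. if k \<in> X then (a' $ k \<bullet> perp (a k)) *\<^sub>R axis 1 1 + (n k * r' $ k) *\<^sub>R axis 2 1 else p' $ k)"
    have "linear F"
      by (rule linearI) (auto simp: F_def vec_eq_iff inner_add_left algebra_simps)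
    moreover have rot: "a' $ k = (a' $ k \<bullet> perp (a k)) *\<^sub>R perp (a k)"
      if "(p', a', r') \<in> ?M" "k \<in> X" for p' a' r' k
    proof -
      have "a k \<bullet> a' $ k = 0" using that by (simp add: point_line_motions_def l_def)
      moreover have "a k \<noteq> 0" using aa[of k] by auto
      ultimately obtain t where t: "a' $ k = t *\<^sub>R perp (a k)"
        using inner_eq_0_imp_perp_multiple by metis
      have "perp (a k) \<bullet> perp (a k) = 1" using aa[of k] by (simp add: inner_real2)
      then show ?thesis by (simp add: t)
    qed
    have "inj_on F ?M"
    proof (rule inj_onI)
      fix x y assume xy: "x \<in> ?M" "y \<in> ?M" "F x = F y"
      obtain p1 a1 r1 p2 a2 r2 where eq: "x = (p1, a1, r1)" "y = (p2, a2, r2)"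
        by (metis prod.exhaust)
      have "p1 $ k = p2 $ k \<and> a1 $ k = a2 $ k \<and> r1 $ k = r2 $ k" for k
      proof -
        have Fk: "F x $ k = F y $ k" using xy by simp
        show ?thesis
        proof (cases "k \<in> X")
          case True
          have "a1 $ k \<bullet> perp (a k) = a2 $ k \<bullet> perp (a k)" "n k * r1 $ k = n k * r2 $ k"
            using Fk True by (auto simp: eq F_def vec_eq_iff forall_2 axis_def)
          then have "a1 $ k = a2 $ k" "r1 $ k = r2 $ k"
            using rot[of p1 a1 r1 k] rot[of p2 a2 r2 k] xy eq True n0[of k] by auto
          moreover have "p1 $ k = p2 $ k"
            using xy True by (simp add: eq point_line_motions_def)
          ultimately show ?thesis by blast
        next
          case False
          then show ?thesis using Fk xy by (simp add: eq F_def point_line_motions_def)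
        qed
      qed
      then show "x = y" by (simp add: eq vec_eq_iff)
    qed
    moreover have "F ` ?M \<subseteq> {z. \<forall>x\<in>(\<lambda>e. pl_row X (e, None) g) ` E'. x \<bullet> z = 0}"
    proof -
      have "pl_row X (e, None) g \<bullet> F x = 0" if e: "e \<in> E'" and x: "x \<in> ?M" for e x
      proof -
        obtain p' a' r' where eq: "x = (p', a', r')" by (metis prod.exhaust)
        have eE: "e \<in> E" using e E'(1) by blast
        then have "card e = 2" using sg by (simp add: simple_graph_def)
        then obtain i j where ij: "e = {i, j}" "i \<noteq> j" "i \<in> X \<longrightarrow> j \<in> X"
          unfolding card_2_iff by (metis insert_commute)
        define t where "t k = a' $ k \<bullet> perp (a k)" for k
        have t: "a' $ k = t k *\<^sub>R perp (a k)" if "k \<in> X" for k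
          using rot x eq that by (simp add: t_def)
        have F: "F x $ k = (if k \<in> X then t k *\<^sub>R axis 1 1 + (n k * r' $ k) *\<^sub>R axis 2 1 else p' $ k)" for k
          by (simp add: F_def eq t_def)
        consider "i \<notin> X" "j \<notin> X" | "i \<notin> X" "j \<in> X" | "i \<in> X" "j \<in> X" using ij(3) by blast
        then show ?thesis
        proof cases
          case 1
          then have "(g $ i - g $ j) \<bullet> (p' $ i - p' $ j) = 0"
            using x eE ij(1) by (simp add: eq point_line_motions_def)
          then show ?thesis using 1
            by (simp add: ij(1) inner_pl_row[OF ij(2)] entry_def F inner_diff_left inner_diff_right)
        next
          case 2
          then have "g $ i \<bullet> a' $ j + p' $ i \<bullet> a j + r' $ j = 0"
            using x eE ij(1) by (simp add: eq point_line_motions_def l_def)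
          then have "n j * (g $ i \<bullet> (t j *\<^sub>R perp (a j)) + p' $ i \<bullet> a j + r' $ j) = 0"
            using t[of j] 2 by simp
          then show ?thesis using 2
            by (simp add: ij(1) inner_pl_row[OF ij(2)] entry_def F inner_real2 axis_def ga[of j] algebra_simps)
        next
          case 3
          then have "a i \<bullet> a' $ j + a' $ i \<bullet> a j = 0"
            using x eE ij(1) by (simp add: eq point_line_motions_def l_def)
          then have "n i * n j * (a i \<bullet> (t j *\<^sub>R perp (a j)) + (t i *\<^sub>R perp (a i)) \<bullet> a j) = 0"
            using t[of i] t[of j] 3 by simp
          then show ?thesis using 3
            by (simp add: ij(1) inner_pl_row[OF ij(2)] entry_def F inner_real2 axis_def ga[of i] ga[of j] algebra_simps)
        qed
      qed
      then show ?thesis by blast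
    qed
    ultimately have "dim ?M \<le> dim {z. \<forall>x\<in>(\<lambda>e. pl_row X (e, None) g) ` E'. x \<bullet> z = 0}"
      using dim_le_linear_inj_on[OF _ subspace_point_line_motions] by blast
    moreover have "dim ((\<lambda>e. pl_row X (e, None) g) ` E') = card E'"
      by (rule indep_family_imp_dim[OF _ ind]) simp
    ultimately show ?thesis
      using dim_orthogonal_complement[of "(\<lambda>e. pl_row X (e, None) g) ` E'"] E'(2) by simp
  qed
  moreover have "3 \<le> dim ?M"
  proof -
    \<comment> \<open>The trivial motions: translation by \<open>\<tau>\<close> plus rotation about
      the origin with angular velocity \<open>\<omega>\<close>. Two vertices already determine both
      parameters.\<close>
    define G :: "(real^2) \<times> real \<Rightarrow> (real^2^'v) \<times> (real^2^'v) \<times> (real^'v)" where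
      "G = (\<lambda>(\<tau>, \<omega>). (\<chi> k. if k \<in> X then 0 else \<tau> + \<omega> *\<^sub>R perp (g $ k),
          \<chi> k. if k \<in> X then \<omega> *\<^sub>R perp (a k) else 0,
          \<chi> k. if k \<in> X then - (\<tau> \<bullet> a k) else 0))"
    have lin: "linear G"
      by (rule linearI) (auto simp: G_def vec_eq_iff inner_add_left algebra_simps)
    have "x = 0" if x0: "G x = 0" for x
    proof -
      obtain \<tau> \<omega> where x: "x = (\<tau>, \<omega>)" by (metis prod.exhaust)
      have pt: "\<tau> + \<omega> *\<^sub>R perp (g $ k) = 0" if "k \<notin> X" for k
        using x0 that by (auto simp: x G_def zero_prod_def vec_eq_iff split: if_splits)
      have ln: "\<omega> = 0 \<and> \<tau> \<bullet> a k = 0" if "k \<in> X" for k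
      proof -
        have "\<omega> *\<^sub>R perp (a k) = 0" "\<tau> \<bullet> a k = 0"
          using x0 that by (auto simp: x G_def zero_prod_def vec_eq_iff split: if_splits)
        moreover have "a k \<noteq> 0" using aa[of k] by auto
        ultimately show ?thesis by simp
      qed
      obtain i j :: 'v where ij: "j \<noteq> i" using other by blast
      consider "i \<notin> X" "j \<notin> X" | "i \<notin> X" "j \<in> X" | "i \<in> X" "j \<notin> X" | "i \<in> X" "j \<in> X" by blast
      then have "\<tau> = 0 \<and> \<omega> = 0"
      proof cases
        case 1
        have "\<omega> *\<^sub>R perp (g $ i - g $ j)
            = (\<tau> + \<omega> *\<^sub>R perp (g $ i)) - (\<tau> + \<omega> *\<^sub>R perp (g $ j))"
          by (simp add: scaleR_diff_right)
        also have "\<dots> = 0" by (simp only: pt[OF 1(1)] pt[OF 1(2)] diff_self)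
        finally have "\<omega> *\<^sub>R perp (g $ i - g $ j) = 0" .
        then have "\<omega> = 0" using nonparallel_neq[OF g ij] by (simp del: perp_diff)
        then show ?thesis using pt[OF 1(1)] by simp
      next
        case 4
        then have "\<omega> = 0" "a i \<bullet> \<tau> = 0" "\<tau> \<bullet> a j = 0" using ln by (auto simp: inner_commute)
        moreover have "a i \<noteq> 0" using aa[of i] by auto
        ultimately obtain c where "\<tau> = c *\<^sub>R perp (a i)"
          using inner_eq_0_imp_perp_multiple by metis
        then show ?thesis using \<open>\<omega> = 0\<close> \<open>\<tau> \<bullet> a j = 0\<close> anp[OF ij] by (simp add: inner_commute)
      next
        case 2
        then show ?thesis using ln[OF 2(2)] pt[OF 2(1)] by simp
      next
        case 3
        then show ?thesis using ln[OF 3(1)] pt[OF 3(2)] by simp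
      qed
      then show ?thesis by (simp add: x zero_prod_def)
    qed
    then have "inj_on G UNIV" using linear_injective_0[OF lin] by blast
    moreover have "G ` UNIV \<subseteq> ?M"
    proof -
      have sw: "perp (a i) \<bullet> a j = - (a i \<bullet> perp (a j))" for i j by (rule inner_perp_swap)
      have "G (\<tau>, \<omega>) \<in> ?M" for \<tau> \<omega>
      proof -
        have PP: "(g $ i - g $ j) \<bullet> (\<tau> + \<omega> *\<^sub>R perp (g $ i) - (\<tau> + \<omega> *\<^sub>R perp (g $ j))) = 0" for i j
        proof -
          have "\<tau> + \<omega> *\<^sub>R perp (g $ i) - (\<tau> + \<omega> *\<^sub>R perp (g $ j)) = \<omega> *\<^sub>R perp (g $ i - g $ j)"
            by (simp add: algebra_simps)
          then show ?thesis by (simp del: perp_diff)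
        qed
        have PL: "g $ i \<bullet> (\<omega> *\<^sub>R perp (a j)) + (\<tau> + \<omega> *\<^sub>R perp (g $ i)) \<bullet> a j - \<tau> \<bullet> a j = 0" for i j
          using inner_perp_swap[of "g $ i" "a j"] by (simp add: inner_add_left)
        have LL: "a i \<bullet> (\<omega> *\<^sub>R perp (a j)) + (\<omega> *\<^sub>R perp (a i)) \<bullet> a j = 0" for i j
          by (simp add: sw)
        show ?thesis
          using PP PL LL by (simp add: G_def point_line_motions_def l_def)
      qed
      then show ?thesis by auto
    qed
    ultimately have "dim (UNIV :: ((real^2) \<times> real) set) \<le> dim ?M"
      by (intro dim_le_linear_inj_on[OF lin]) auto
    then show ?thesis by simp
  qed
  ultimately show ?thesis using fw unfolding point_line_inf_rigid_def by (metis le_antisym)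
qed

theorem theorem2p5:
  fixes E :: "'v::finite set set" and X :: "'v set"
  assumes "simple_graph E"
  shows
    "((\<exists>p :: 'v \<Rightarrow> real^2. bar_joint_inf_rigid E p \<and> collinear (p ` X))
       \<longleftrightarrow> (\<exists>p l. point_line_framework X E p l \<and> point_line_inf_rigid X E p l))
     \<and>
     ((\<exists>p l. point_line_framework X E p l \<and> point_line_inf_rigid X E p l)
       \<longleftrightarrow> (\<exists>E' \<subseteq> E. int (card E') = 2 * int (card (UNIV :: 'v set)) - 3 \<and>
              (\<forall>A \<subseteq> E'. A \<noteq> {} \<longrightarrow> (\<forall>P. partition_on A P \<longrightarrow>
                 int (card A) \<le>
                   (\<Sum>B\<in>P. 2 * int (nu (UNIV - X) B) + int (nu X B) - 2) + int (nu X A) - 1))))"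
    (is "(?a \<longleftrightarrow> ?b) \<and> (?b \<longleftrightarrow> ?c)")
proof -
  have "?a \<Longrightarrow> ?c" using bar_joint_imp_count[OF assms] by blast
  moreover have "?c \<Longrightarrow> ?b"
  proof -
    assume ?c
    then obtain E' where E': "E' \<subseteq> E" "int (card E') = 2 * int (card (UNIV :: 'v set)) - 3"
      and count: "\<And>A P. A \<subseteq> E' \<Longrightarrow> A \<noteq> {} \<Longrightarrow> partition_on A P \<Longrightarrow> int (card A) \<le>
       (\<Sum>B\<in>P. 2 * int (nu (UNIV - X) B) + int (nu X B) - 2) + int (nu X A) - 1"
      by auto
    have edges: "card e = 2" if "e \<in> E'" for e
      using that E'(1) assms by (auto simp: simple_graph_def)
    obtain g where "nonparallel g" "indep_family (\<lambda>e. pl_row X (e, None) g) E'"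
      using count_imp_independent_rows[OF edges count] by blast
    then show ?b using independent_rows_imp_point_line[OF assms E'] by blast
  qed
  moreover have "?b \<Longrightarrow> ?a" using point_line_imp_bar_joint[OF assms] by blast
  ultimately show ?thesis by blast
qed

end
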